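(* Let $k\ge 1$ be an integer and let $G$ be a proper $k$-mixed-thin graph. Then the twin-width of $G$, i.e., the symmetric twin-width of its adjacency matrix $\boldsymbol{A}(G)$, is at most $9k$. Moreover, a corresponding contraction sequence for $G$ (a symmetric $9k$-contraction sequence of $\boldsymbol{A}(G)$) can be computed in polynomial time from the vertex partition $(V_1,\ldots,V_k)$ and the linear orders $\le_{ij}$ ($1\le i\le j\le k$) that witness that $G$ is proper $k$-mixed-thin.
   Context: Graphs are finite and simple. **Proper $k$-mixed-thin.** Let $G=(V,E)$ be a graph, $k>0$ an integer, and $\bar E=\binom{V}{2}\setminus E$. Two linear orders on the same set are *aligned* if they are the same or one is the inverse of the other. $G$ is *proper $k$-mixed-thin* if there exist a partition $(V_1,\ldots,V_k)$ of $V$ and, for each $1\le i\le j\le k$, a linear order $\le_{ij}$ on $V_i\cup V_j$ and a choice of $E_{i,j}\in\{E,\bar E\}$ such that for every $1\le i\le j\le k$ (writing $\lneq_{ij}$ for the strict order): (a) the restriction of $\le_{ij}$ to $V_i$ (resp. to $V_j$) is aligned with $\le_{ii}$ (resp. $\le_{jj}$); (b) for every triple $u,v,w$ such that ($\{u,v\}\subseteq V_i$ and $w\in V_j$) or ($\{u,v\}\subseteq V_j$ and $w\in V_i$): if $u\lneq_{ij}v\lneq_{ij}w$ and $uw\in E_{i,j}$, then $vw\in E_{i,j}$; (c) for every triple $u,v,w$ such that ($\{v,w\}\subseteq V_i$ and $u\in V_j$) or ($\{v,w\}\subseteq V_j$ and $u\in V_i$): if $u\lneq_{ij}v\lneq_{ij}w$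 and $uw\in E_{i,j}$, then $uv\in E_{i,j}$. **Twin-width.** Consider square matrices with entries in $\{0,1,r\}$, rows and columns indexed by the same set; $r$ is the *red* entry. The *red number* of a matrix is the maximum number of red entries over all its rows and columns. *Contraction* of rows (resp. columns) $p$ and $q$ gives the matrix obtained by deleting $q$ and replacing entries of $p$ by $r$ whenever they differ from the corresponding entries of $q$. A *contraction sequence* of a matrix goes from the matrix down to a $1\times 1$ matrix by successive contractions. It is *symmetric* if every contraction of a pair of rows (resp. columns) is immediately followed by the contraction of the corresponding pair of columns (resp. rows). A symmetric contraction sequence is a (symmetric) *$d$-contraction sequence* if the red number is at most $d$ for every matrix in it, counted only after both the row contraction and the corresponding column contraction are performed. The *symmetric twin-width* of a matrix is the minimum $d$ for which it has a symmetric $d$-contraction sequence. The *twin-width* of a graph $G$ is the symmetric twin-width of its adjacency matrix $\boldsymbol{A}(G)$ (red entries on the main diagonal are counted). *)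

theory Defs
  imports Complex_Main "HOL-Library.Disjoint_Sets" "HOL-Library.Extended_Nat"
    "HOL-Computational_Algebra.Polynomial"
begin

section \<open>Proper mixed-thin graphs\<close>

definition all_pairs :: "'a set \<Rightarrow> 'a set set" where
  "all_pairs V = {e. e \<subseteq> V \<and> card e = 2}"

definition simple_graph :: "'a set \<Rightarrow> 'a set set \<Rightarrow> bool" where
  "simple_graph V E \<longleftrightarrow> finite V \<and> E \<subseteq> all_pairs V"

definition aligned :: "'a rel \<Rightarrow> 'a rel \<Rightarrow> bool" where
  "aligned r s \<longleftrightarrow> r = s \<or> r = s\<inverse>"

text \<open>The parts of the partition are \<open>P 1, \<dots>, P k\<close>; some of them may be empty.
  The order \<open>L i j\<close> and the edge set \<open>F i j\<close> (either \<open>E\<close> or its complement) are relevant for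
  \<open>1 \<le> i \<le> j \<le> k\<close> only.\<close>

definition mixed_thin_witness ::
  "nat \<Rightarrow> 'a set \<Rightarrow> 'a set set \<Rightarrow> (nat \<Rightarrow> 'a set) \<Rightarrow> (nat \<Rightarrow> nat \<Rightarrow> 'a rel) \<Rightarrow> (nat \<Rightarrow> nat \<Rightarrow> 'a set set) \<Rightarrow> bool"
where
  "mixed_thin_witness k V E P L F \<longleftrightarrow>
    (\<Union>i\<in>{1..k}. P i) = V \<and> disjoint_family_on P {1..k} \<and>
    (\<forall>i j. 1 \<le> i \<and> i \<le> j \<and> j \<le> k \<longrightarrow>
      linear_order_on (P i \<union> P j) (L i j) \<and>
      F i j \<in> {E, all_pairs V - E} \<and>
      aligned (Restr (L i j) (P i)) (L i i) \<and>
      aligned (Restr (L i j) (P j)) (L j j) \<and>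
      (\<forall>u v w. ({u, v} \<subseteq> P i \<and> w \<in> P j \<or> {u, v} \<subseteq> P j \<and> w \<in> P i) \<longrightarrow>
        (u, v) \<in> L i j - Id \<longrightarrow> (v, w) \<in> L i j - Id \<longrightarrow>
        {u, w} \<in> F i j \<longrightarrow> {v, w} \<in> F i j) \<and>
      (\<forall>u v w. ({v, w} \<subseteq> P i \<and> u \<in> P j \<or> {v, w} \<subseteq> P j \<and> u \<in> P i) \<longrightarrow>
        (u, v) \<in> L i j - Id \<longrightarrow> (v, w) \<in> L i j - Id \<longrightarrow>
        {u, w} \<in> F i j \<longrightarrow> {u, v} \<in> F i j))"

definition proper_mixed_thin :: "nat \<Rightarrow> 'a set \<Rightarrow> 'a set set \<Rightarrow> bool" where
  "proper_mixed_thin k V E \<longleftrightarrow> (\<exists>P L F. mixed_thin_witness k V E P L F)"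


section \<open>Symmetric twin-width\<close>

datatype symbol = Zero | One | Red

text \<open>The function \<open>entry\<close> is relevant on \<open>rows M \<times> cols M\<close> only.  A matrix in the middle of a
  symmetric contraction sequence is not square, so rows and columns have separate index sets.\<close>

record 'a matrix =
  rows :: "'a set"
  cols :: "'a set"
  entry :: "'a \<Rightarrow> 'a \<Rightarrow> symbol"

datatype 'a contraction = Contract_Rows 'a 'a | Contract_Cols 'a 'a

definition merge :: "symbol \<Rightarrow> symbol \<Rightarrow> symbol" where
  "merge a b = (if a \<noteq> b then Red else a)"

fun contractible :: "'a contraction \<Rightarrow> 'a matrix \<Rightarrow> bool" where
  "contractible (Contract_Rows p q) M \<longleftrightarrow> p \<in> rows M \<and> q \<in> rows M \<and> p \<noteq> q"
| "contractible (Contract_Cols p q) M \<longleftrightarrow> p \<in> cols M \<and> q \<in> cols M \<and> p \<noteq> q"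

fun contract :: "'a contraction \<Rightarrow> 'a matrix \<Rightarrow> 'a matrix" where
  "contract (Contract_Rows p q) M =
     M\<lparr>rows := rows M - {q},
       entry := (\<lambda>x y. if x = p then merge (entry M p y) (entry M q y) else entry M x y)\<rparr>"
| "contract (Contract_Cols p q) M =
     M\<lparr>cols := cols M - {q},
       entry := (\<lambda>x y. if y = p then merge (entry M x p) (entry M x q) else entry M x y)\<rparr>"

text \<open>A contraction sequence is represented by the list of its contractions; its matrices are
  \<open>fold contract (take i cs) M\<close> for \<open>i \<le> length cs\<close>.\<close>

definition contraction_sequence :: "'a matrix \<Rightarrow> 'a contraction list \<Rightarrow> bool" where
  "contraction_sequence M cs \<longleftrightarrow>
    (\<forall>i < length cs. contractible (cs ! i) (fold contract (take i cs) M)) \<and>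
    card (rows (fold contract cs M)) = 1 \<and> card (cols (fold contract cs M)) = 1"

fun symmetric_sequence :: "'a contraction list \<Rightarrow> bool" where
  "symmetric_sequence [] = True"
| "symmetric_sequence (Contract_Rows p q # Contract_Cols p' q' # cs) =
     (p' = p \<and> q' = q \<and> symmetric_sequence cs)"
| "symmetric_sequence (Contract_Cols p q # Contract_Rows p' q' # cs) =
     (p' = p \<and> q' = q \<and> symmetric_sequence cs)"
| "symmetric_sequence _ = False"

definition red_number :: "'a matrix \<Rightarrow> nat" where
  "red_number M = Max
    ((\<lambda>x. card {y \<in> cols M. entry M x y = Red}) ` rows M \<union>
     (\<lambda>y. card {x \<in> rows M. entry M x y = Red}) ` cols M)"

text \<open>Even positions are the ones at which each row (column) contraction has been completed by
  its column (row) counterpart.\<close>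

definition symmetric_contraction_sequence :: "nat \<Rightarrow> 'a matrix \<Rightarrow> 'a contraction list \<Rightarrow> bool" where
  "symmetric_contraction_sequence d M cs \<longleftrightarrow>
    contraction_sequence M cs \<and> symmetric_sequence cs \<and>
    (\<forall>i \<le> length cs. even i \<longrightarrow> red_number (fold contract (take i cs) M) \<le> d)"

text \<open>The infimum is attained unless it is \<open>\<infinity>\<close>, which means that there is no symmetric contraction
  sequence at all (as for the empty matrix).\<close>

definition symmetric_twin_width :: "'a matrix \<Rightarrow> enat" where
  "symmetric_twin_width M = Inf {enat d |d. \<exists>cs. symmetric_contraction_sequence d M cs}"

definition adjacency_matrix :: "'a set \<Rightarrow> 'a set set \<Rightarrow> 'a matrix" where
  "adjacency_matrix V E =
    \<lparr>rows = V, cols = V, entry = (\<lambda>x y. if {x, y} \<in> E then One else Zero)\<rparr>"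

definition twin_width :: "'a set \<Rightarrow> 'a set set \<Rightarrow> enat" where
  "twin_width V E = symmetric_twin_width (adjacency_matrix V E)"


section \<open>Polynomial time\<close>

text \<open>The model of computation is first-order pure LISP over binary trees (the language F of
  N. D. Jones, Computability and Complexity from a Programming Perspective), with unit cost for
  every elementary operation.  A program is a list of function bodies; the body of a function
  refers to its arguments by position, and function 0 is the main one.  The only test is whether a
  tree is a leaf, and every step allocates at most one node.  Storing trees with sharing, a Turing
  machine therefore simulates a run with polynomial overhead; the cost of writing out the result
  without sharing is accounted for in \<open>computes_within\<close>.\<close>

datatype tree = Leaf | Node tree tree

datatype expr =
    Param nat
  | Mk_Leaf
  | Mk_Node expr expr
  | Left expr
  | Right expr
  | If_Node expr expr expr
  | Call nat "expr list"

type_synonym program = "expr list"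

fun left :: "tree \<Rightarrow> tree" where
  "left Leaf = Leaf"
| "left (Node a b) = a"

fun right :: "tree \<Rightarrow> tree" where
  "right Leaf = Leaf"
| "right (Node a b) = b"

text \<open>\<open>run Q xs e v t\<close>: with argument values \<open>xs\<close>, the expression \<open>e\<close> evaluates to \<open>v\<close> in \<open>t\<close> steps.\<close>

inductive run :: "program \<Rightarrow> tree list \<Rightarrow> expr \<Rightarrow> tree \<Rightarrow> nat \<Rightarrow> bool"
  and runs :: "program \<Rightarrow> tree list \<Rightarrow> expr list \<Rightarrow> tree list \<Rightarrow> nat \<Rightarrow> bool"
  for Q :: program
where
  run_Param: "i < length xs \<Longrightarrow> run Q xs (Param i) (xs ! i) 1"
| run_Leaf: "run Q xs Mk_Leaf Leaf 1"
| run_Node: "run Q xs a v s \<Longrightarrow> run Q xs b w t \<Longrightarrow> run Q xs (Mk_Node a b) (Node v w) (s + t + 1)"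
| run_Left: "run Q xs a v t \<Longrightarrow> run Q xs (Left a) (left v) (t + 1)"
| run_Right: "run Q xs a v t \<Longrightarrow> run Q xs (Right a) (right v) (t + 1)"
| run_If_True: "run Q xs c (Node l r) s \<Longrightarrow> run Q xs a v t \<Longrightarrow> run Q xs (If_Node c a b) v (s + t + 1)"
| run_If_False: "run Q xs c Leaf s \<Longrightarrow> run Q xs b v t \<Longrightarrow> run Q xs (If_Node c a b) v (s + t + 1)"
| run_Call: "f < length Q \<Longrightarrow> runs Q xs as ys s \<Longrightarrow> run Q ys (Q ! f) v t \<Longrightarrow>
    run Q xs (Call f as) v (s + t + 1)"
| runs_Nil: "runs Q xs [] [] 0"
| runs_Cons: "run Q xs a v s \<Longrightarrow> runs Q xs as vs t \<Longrightarrow> runs Q xs (a # as) (v # vs) (s + t)"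

definition computes_within :: "program \<Rightarrow> tree \<Rightarrow> tree \<Rightarrow> nat \<Rightarrow> bool" where
  "computes_within Q x y b \<longleftrightarrow> Q \<noteq> [] \<and> (\<exists>t. run Q [x] (Q ! 0) y t \<and> t + size y \<le> b)"

text \<open>Encodings; numbers are in unary.\<close>

fun encode_nat :: "nat \<Rightarrow> tree" where
  "encode_nat 0 = Leaf"
| "encode_nat (Suc n) = Node Leaf (encode_nat n)"

fun encode_bool :: "bool \<Rightarrow> tree" where
  "encode_bool False = Leaf"
| "encode_bool True = Node Leaf Leaf"

fun encode_list :: "('b \<Rightarrow> tree) \<Rightarrow> 'b list \<Rightarrow> tree" where
  "encode_list f [] = Leaf"
| "encode_list f (x # xs) = Node (f x) (encode_list f xs)"

fun encode_contraction :: "nat contraction \<Rightarrow> tree" where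
  "encode_contraction (Contract_Rows p q) = Node (encode_bool False) (Node (encode_nat p) (encode_nat q))"
| "encode_contraction (Contract_Cols p q) = Node (encode_bool True) (Node (encode_nat p) (encode_nat q))"

definition encode_set :: "nat \<Rightarrow> nat set \<Rightarrow> tree" where
  "encode_set n A = encode_list encode_bool (map (\<lambda>u. u \<in> A) [0..<n])"

definition encode_rel :: "nat \<Rightarrow> nat rel \<Rightarrow> tree" where
  "encode_rel n R = encode_list (\<lambda>u. encode_list (\<lambda>v. encode_bool ((u, v) \<in> R)) [0..<n]) [0..<n]"

text \<open>The input of the algorithm: a graph on the vertex set \<open>{0..<n}\<close> (as its adjacency matrix), the
  parts \<open>P 1, \<dots>, P k\<close> and the orders \<open>L i j\<close> for \<open>1 \<le> i \<le> j \<le> k\<close>.\<close>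

definition encode_input ::
  "nat \<Rightarrow> nat \<Rightarrow> nat set set \<Rightarrow> (nat \<Rightarrow> nat set) \<Rightarrow> (nat \<Rightarrow> nat \<Rightarrow> nat rel) \<Rightarrow> tree"
where
  "encode_input k n E P L =
    Node (encode_rel n {(u, v). {u, v} \<in> E})
      (Node (encode_list (\<lambda>i. encode_set n (P i)) [1..<Suc k])
        (encode_list (\<lambda>i. encode_list (\<lambda>j. encode_rel n (L i j)) [i..<Suc k]) [1..<Suc k]))"

end

theory Submission
  imports Defs
begin

text \<open>For \<open>i \<le> j\<close>, the entries of the block \<open>P i \<times> P j\<close> that lie before and after the band of pairs in
  \<open>F i j\<close> are separated from it by two monotone staircases.  Cut every \<open>P i\<close> into intervals of its order.
  The pairs of intervals that a staircase touches form a chain, so that the block contains at most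
  \<open>2 (m\<^sub>i + m\<^sub>j)\<close> touched pairs, where \<open>m\<^sub>i\<close> is the number of intervals in \<open>P i\<close>, and there are at
  most \<open>4 k m\<close> touched pairs altogether, where \<open>m = \<Sum>\<^sub>i m\<^sub>i\<close>.  There are at least \<open>m - k\<close> pairs of
  consecutive intervals; as \<open>8 k m < 9 k (m - k)\<close> for \<open>m > 9 k\<close>, two of them can be merged into an
  interval that touches at most \<open>9 k\<close> others, and the degrees of the other intervals do not grow.  When
  only \<open>9 k\<close> parts are left, they are merged arbitrarily.  The greedy algorithm that looks for such a
  pair needs the graph and the orders \<open>L i i\<close> only.\<close>

section \<open>Linear orders and chains\<close>

text \<open>The constant 9 is where two thresholds meet. With \<open>c * k\<close> in place of
  \<open>9 * k\<close>, averaging yields a good pair as soon as \<open>(c - 8) * m > c * k\<close>,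
  while arbitrary merges are harmless only up to \<open>c * k\<close> parts, since a row then has no
  more than \<open>c * k\<close> entries. The first condition must hold for all
  \<open>m > c * k\<close>, and \<open>c = 9\<close> is the least integer for which it does. The 8
  is twice the 4 of the count of touched pairs, because an interval belongs to at most two
  consecutive pairs. The number of red entries itself is no invariant of merging: constant
  neighbouring blocks with different values give a red one. Degrees are therefore counted through
  windows (a vertex with its successor), which do not refer to the partition. The chain argument
  needs windows in both coordinates (\<open>meets\<close>), the degree of an interval
  \<open>U\<close> needs all of \<open>U\<close> against one window (\<open>cuts\<close>); convexity
  of \<open>U\<close> leads from the second form to the first. Red diagonal entries are charged to
  the clause \<open>z \<in> U\<close> of \<open>cuts\<close>.\<close>

definition covers :: "'a rel \<Rightarrow> 'a \<Rightarrow> 'a \<Rightarrow> bool" where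
  "covers T x y \<longleftrightarrow> x \<noteq> y \<and> (x, y) \<in> T \<and> (\<forall>z. (x, z) \<in> T \<longrightarrow> (z, y) \<in> T \<longrightarrow> z = x \<or> z = y)"

text \<open>A change of adjacency between consecutive vertices lies inside one window, so windows
  detect every nonconstant row of an interval. The last vertex of a class has a singleton
  window.\<close>

definition window :: "'a rel \<Rightarrow> 'a \<Rightarrow> 'a set" where
  "window T x = insert x {y. covers T x y}"

definition convex_in :: "'a rel \<Rightarrow> 'a set \<Rightarrow> bool" where
  "convex_in T X \<longleftrightarrow> (\<forall>x\<in>X. \<forall>z\<in>X. \<forall>y. (x, y) \<in> T \<longrightarrow> (y, z) \<in> T \<longrightarrow> y \<in> X)"

definition adjacent :: "'a rel \<Rightarrow> 'a set \<Rightarrow> 'a set \<Rightarrow> bool" where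
  "adjacent T X Y \<longleftrightarrow> (\<exists>x\<in>X. \<exists>y\<in>Y. covers T x y)"

text \<open>The condition \<open>a \<noteq> b\<close> ignores the main diagonal of the adjacency matrix, which does not fit
  the staircase shape of a block on the diagonal.\<close>

definition mixed :: "'a set set \<Rightarrow> 'a set \<Rightarrow> 'a set \<Rightarrow> bool" where
  "mixed E A B \<longleftrightarrow> (\<exists>a\<in>A. \<exists>b\<in>B. a \<noteq> b \<and> {a, b} \<in> E) \<and> (\<exists>a\<in>A. \<exists>b\<in>B. a \<noteq> b \<and> {a, b} \<notin> E)"

text \<open>A part counts for \<open>U\<close> as soon as \<open>U\<close> tells one of its vertices apart from the successor of that
  vertex, even if the successor belongs to the next part.  This makes \<open>cut_degree\<close> monotone: two
  neighbouring entries \<open>0\<close> and \<open>1\<close> of a row become a red one when their columns are merged, but the first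
  of the two parts has been counted before.\<close>

definition cuts :: "'a set set \<Rightarrow> 'a rel \<Rightarrow> 'a set \<Rightarrow> 'a \<Rightarrow> bool" where
  "cuts E T U z \<longleftrightarrow> z \<in> U \<or> mixed E U (window T z)"

definition cut_degree :: "'a set set \<Rightarrow> 'a rel \<Rightarrow> 'a set set \<Rightarrow> 'a set \<Rightarrow> nat" where
  "cut_degree E T \<P> U = card {Z \<in> \<P>. \<exists>z\<in>Z. cuts E T U z}"

text \<open>A down-set of the product of \<open>r\<close> and the converse of \<open>s\<close>; its
  boundary is the monotone staircase.\<close>

definition staircase :: "'a rel \<Rightarrow> 'a rel \<Rightarrow> ('a \<Rightarrow> 'a \<Rightarrow> bool) \<Rightarrow> bool" where
  "staircase r s h \<longleftrightarrow> (\<forall>a a' b b'. (a, a') \<in> r \<longrightarrow> (b', b) \<in> s \<longrightarrow> h a' b' \<longrightarrow> h a b)"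

definition splits :: "('a \<Rightarrow> 'a \<Rightarrow> bool) \<Rightarrow> 'a set \<Rightarrow> 'a set \<Rightarrow> bool" where
  "splits h A B \<longleftrightarrow> (\<exists>a\<in>A. \<exists>b\<in>B. h a b) \<and> (\<exists>a\<in>A. \<exists>b\<in>B. \<not> h a b)"

lemma staircaseD:
  "staircase r s h \<Longrightarrow> (a, a') \<in> r \<Longrightarrow> (b', b) \<in> s \<Longrightarrow> h a' b' \<Longrightarrow> h a b"
  unfolding staircase_def by blast

lemma linear_orderD:
  assumes "linear_order_on A r"
  shows "r \<subseteq> A \<times> A" "trans r" "antisym r" "x \<in> A \<Longrightarrow> (x, x) \<in> r"
    "x \<in> A \<Longrightarrow> y \<in> A \<Longrightarrow> (x, y) \<in> r \<or> (y, x) \<in> r"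
proof -
  show "r \<subseteq> A \<times> A" "trans r" "antisym r" and refl: "x \<in> A \<Longrightarrow> (x, x) \<in> r"
    using assms by (auto simp: order_on_defs refl_on_def)
  show "x \<in> A \<Longrightarrow> y \<in> A \<Longrightarrow> (x, y) \<in> r \<or> (y, x) \<in> r"
    using assms refl by (cases "x = y") (simp_all add: order_on_defs total_on_def)
qed

lemma card_underS_less_card:
  assumes "linear_order_on A r" "finite A" "x \<in> A"
  shows "card (underS r x) < card A"
proof -
  have "underS r x \<subseteq> A - {x}"
    using linear_orderD(1)[OF assms(1)] by (auto simp: underS_def)
  then show ?thesis
    using assms(2,3) by (meson card_Diff1_less card_mono finite_Diff le_less_trans)
qed

lemma card_underS_strict_mono:
  assumes r: "linear_order_on A r" "finite A" and x: "(x, x') \<in> r" "x \<noteq> x'"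
  shows "card (underS r x) < card (underS r x')"
proof (rule psubset_card_mono)
  note d = linear_orderD[OF r(1)]
  show "finite (underS r x')"
    by (rule finite_subset[OF _ r(2)]) (use d(1) in \<open>auto simp: underS_def\<close>)
  have "underS r x \<subseteq> underS r x'"
    using x d(2,3) by (auto simp: underS_def dest: transD antisymD)
  moreover have "x \<in> underS r x'" "x \<notin> underS r x"
    using x by (auto simp: underS_def)
  ultimately show "underS r x \<subset> underS r x'" by blast
qed

text \<open>The sum of the two ranks increases strictly along the chain and stays below
  \<open>card A + card B\<close>, so it is injective on \<open>R\<close>. Pairs with the same first
  component are told apart by the rank of the second.\<close>

lemma chain_card_le:
  assumes r: "linear_order_on A r" and s: "linear_order_on B s"
    and fin: "finite A" "finite B" and R: "R \<subseteq> A \<times> B"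
    and chain: "\<And>a b a' b'. (a, b) \<in> R \<Longrightarrow> (a', b') \<in> R \<Longrightarrow> (a, a') \<in> r \<Longrightarrow> a \<noteq> a' \<Longrightarrow> (b, b') \<in> s"
  shows "card R \<le> card A + card B"
proof -
  define f where "f = (\<lambda>(a, b). card (underS r a) + card (underS s b))"
  have less: "f (a, b) < f (a', b')"
    if "(a, b) \<in> R" "(a', b') \<in> R" "(a, a') \<in> r" "a \<noteq> a'" for a b a' b'
  proof -
    have "card (underS s b) \<le> card (underS s b')"
      using card_underS_strict_mono[OF s fin(2)] chain[OF that] by (cases "b = b'") (auto intro: less_imp_le)
    then show ?thesis
      using card_underS_strict_mono[OF r fin(1) that(3,4)] by (simp add: f_def)
  qed
  have less2: "f (a, b) \<noteq> f (a, b')" if "(a, b) \<in> R" "(a, b') \<in> R" "b \<noteq> b'" for a b b'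
    using card_underS_strict_mono[OF s fin(2), of b b'] card_underS_strict_mono[OF s fin(2), of b' b]
      linear_orderD(5)[OF s, of b b'] that R by (fastforce simp: f_def)
  have "inj_on f R"
  proof (rule inj_onI)
    fix p q assume pq: "p \<in> R" "q \<in> R" "f p = f q"
    obtain a b a' b' where [simp]: "p = (a, b)" "q = (a', b')" by (cases p, cases q)
    have "a = a'"
      using less[of a b a' b'] less[of a' b' a b] linear_orderD(5)[OF r, of a a'] pq R by auto
    then show "p = q"
      using less2[of a b b'] pq by auto
  qed
  moreover have "f ` R \<subseteq> {..<card A + card B}"
    using card_underS_less_card[OF r fin(1)] card_underS_less_card[OF s fin(2)] R
    by (fastforce simp: f_def intro: add_strict_mono)
  ultimately show ?thesis
    by (metis card_image card_lessThan card_mono finite_lessThan)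
qed

text \<open>Induction on the number of elements between \<open>x\<close> and \<open>y\<close>: an
  intermediate \<open>z\<close> yields two smaller intervals, each missing one endpoint.\<close>

lemma rtranclp_covers:
  assumes "finite T" "trans T" "antisym T" "(x, y) \<in> T"
    and refl: "\<And>x y. (x, y) \<in> T \<Longrightarrow> (x, x) \<in> T \<and> (y, y) \<in> T"
  shows "(covers T)\<^sup>*\<^sup>* x y"
  using assms(4)
proof (induction "card {z. (x, z) \<in> T \<and> (z, y) \<in> T}" arbitrary: x y rule: less_induct)
  case less
  show ?case
  proof (cases "x = y \<or> covers T x y")
    case False
    then obtain z where z: "(x, z) \<in> T" "(z, y) \<in> T" "z \<noteq> x" "z \<noteq> y"
      using less.prems by (auto simp: covers_def)
    have fin: "finite {z. (x, z) \<in> T \<and> (z, y) \<in> T}"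
      by (rule finite_subset[of _ "snd ` T"]) (use assms(1) in force)+
    have ne: "(y, z) \<notin> T" "(z, x) \<notin> T"
      using z assms(3) by (auto dest: antisymD)
    have "{w. (x, w) \<in> T \<and> (w, z) \<in> T} \<subseteq> {w. (x, w) \<in> T \<and> (w, y) \<in> T} - {y}"
      using ne(1) transD[OF assms(2) _ z(2)] by auto
    moreover have "{w. (z, w) \<in> T \<and> (w, y) \<in> T} \<subseteq> {w. (x, w) \<in> T \<and> (w, y) \<in> T} - {x}"
      using ne(2) transD[OF assms(2) z(1)] by auto
    moreover have "x \<in> {w. (x, w) \<in> T \<and> (w, y) \<in> T}" "y \<in> {w. (x, w) \<in> T \<and> (w, y) \<in> T}"
      using refl less.prems by auto
    ultimately have "(covers T)\<^sup>*\<^sup>* x z" "(covers T)\<^sup>*\<^sup>* z y"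
      using z(1,2) by (auto intro!: less.hyps psubset_card_mono[OF fin])
    then show ?thesis by simp
  qed auto
qed

lemma covers_path_const:
  assumes T: "finite T" "trans T" "antisym T" "\<And>x y. (x, y) \<in> T \<Longrightarrow> (x, x) \<in> T \<and> (y, y) \<in> T"
    and X: "convex_in T X" "x \<in> X" "x' \<in> X" "(x, x') \<in> T"
    and step: "\<And>u v. u \<in> X \<Longrightarrow> v \<in> X \<Longrightarrow> covers T u v \<Longrightarrow> f u = f v"
  shows "f x = f x'"
proof -
  have "(covers T)\<^sup>*\<^sup>* x x'"
    using T(1-3) X(4) T(4) by (rule rtranclp_covers)
  \<comment> \<open>The path runs forwards from \<open>x\<close>, but membership in \<open>X\<close>
    is inherited backwards: by convexity, a path vertex in \<open>X\<close> has its predecessor in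
    \<open>X\<close>. This uses that the predecessor is above \<open>x\<close>, hence the second
    conjunct.\<close>
  then have "(x' \<in> X \<longrightarrow> f x = f x') \<and> (x = x' \<or> (x, x') \<in> T)"
  proof (induction rule: rtranclp_induct)
    case (step u v)
    have uv: "(u, v) \<in> T" using step.hyps(2) by (simp add: covers_def)
    then have "u \<in> X" if "v \<in> X"
      using step.IH that X(1,2) unfolding convex_in_def by blast
    moreover have "(x, v) \<in> T"
      using uv step.IH transD[OF T(2) _ uv] by auto
    ultimately show ?case
      using step.IH step.hyps(2) assms(9) by auto
  qed simp
  then show ?thesis using X(3) by blast
qed

text \<open>Nothing lies strictly between \<open>x\<close> and its successor, so the successor is at
  most \<open>x'\<close>. Windows at different vertices thus share at most one vertex.\<close>

lemma windows_sep:
  assumes lin: "linear_order_on A r" and r: "r \<subseteq> T" and A: "\<And>x y. x \<in> A \<Longrightarrow> (x, y) \<in> T \<Longrightarrow> (x, y) \<in> r"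
    and x: "(x, x') \<in> r" "x \<noteq> x'" and a: "a \<in> window T x" "a' \<in> window T x'"
  shows "(a, a') \<in> r"
proof -
  note d = linear_orderD[OF lin]
  have "x \<in> A" "x' \<in> A" using x d(1) by auto
  have "a' \<in> A" "(x', a') \<in> r"
    using a(2) d(1,4) A \<open>x' \<in> A\<close> by (auto simp: window_def covers_def)
  have "(a, x') \<in> r"
  proof (cases "a = x")
    case False
    then have c: "covers T x a" using a by (auto simp: window_def)
    then have "(x, a) \<in> r" using A \<open>x \<in> A\<close> by (auto simp: covers_def)
    then have "a \<in> A" using d(1) by auto
    have "(x', a) \<in> r \<Longrightarrow> x' = a" using c x r by (auto simp: covers_def)
    then show ?thesis using d(4,5) \<open>a \<in> A\<close> \<open>x' \<in> A\<close> by blast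
  qed (use x in simp)
  then show ?thesis using \<open>(x', a') \<in> r\<close> d(2) by (blast dest: transD)
qed

section \<open>Blocks of a mixed-thin graph\<close>

locale mixed_thin =
  fixes k :: nat and V :: "'a set" and E :: "'a set set" and P :: "nat \<Rightarrow> 'a set"
    and L :: "nat \<Rightarrow> nat \<Rightarrow> 'a rel" and F :: "nat \<Rightarrow> nat \<Rightarrow> 'a set set"
  assumes graph: "simple_graph V E" and witness: "mixed_thin_witness k V E P L F"
begin

text \<open>The classes are disjoint, so successors under \<open>T\<close> never leave a class and a
  single relation carries all class orders.\<close>

definition T :: "'a rel" where
  "T = (\<Union>i\<in>{1..k}. L i i)"

lemma finite_V: "finite V"
  using graph by (simp add: simple_graph_def)

lemma Union_P: "(\<Union>i\<in>{1..k}. P i) = V"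
  using witness by (simp add: mixed_thin_witness_def)

lemma P_disjoint: "i \<in> {1..k} \<Longrightarrow> j \<in> {1..k} \<Longrightarrow> x \<in> P i \<Longrightarrow> x \<in> P j \<Longrightarrow> i = j"
  using witness unfolding mixed_thin_witness_def disjoint_family_on_def by blast

lemma P_subset_V: "i \<in> {1..k} \<Longrightarrow> P i \<subseteq> V"
  using Union_P by blast

lemma finite_P: "i \<in> {1..k} \<Longrightarrow> finite (P i)"
  using P_subset_V finite_V by (rule finite_subset)

lemma pair_witness:
  assumes "1 \<le> i" "i \<le> j" "j \<le> k"
  shows "linear_order_on (P i \<union> P j) (L i j)" "F i j \<in> {E, all_pairs V - E}"
    "aligned (Restr (L i j) (P i)) (L i i)" "aligned (Restr (L i j) (P j)) (L j j)"
    "{u, v} \<subseteq> P i \<and> w \<in> P j \<or> {u, v} \<subseteq> P j \<and> w \<in> P i \<Longrightarrow>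
      (u, v) \<in> L i j - Id \<Longrightarrow> (v, w) \<in> L i j - Id \<Longrightarrow> {u, w} \<in> F i j \<Longrightarrow> {v, w} \<in> F i j"
    "{v, w} \<subseteq> P i \<and> u \<in> P j \<or> {v, w} \<subseteq> P j \<and> u \<in> P i \<Longrightarrow>
      (u, v) \<in> L i j - Id \<Longrightarrow> (v, w) \<in> L i j - Id \<Longrightarrow> {u, w} \<in> F i j \<Longrightarrow> {u, v} \<in> F i j"
  using witness assms unfolding mixed_thin_witness_def by (elim conjE, metis)+

lemma linear_L: "i \<in> {1..k} \<Longrightarrow> linear_order_on (P i) (L i i)"
  using pair_witness(1)[of i i] by simp

lemma T_E:
  assumes "(x, y) \<in> T"
  obtains i where "i \<in> {1..k}" "x \<in> P i" "y \<in> P i" "(x, y) \<in> L i i"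
  using assms linear_orderD(1)[OF linear_L] unfolding T_def by blast

lemma T_iff: "i \<in> {1..k} \<Longrightarrow> x \<in> P i \<or> y \<in> P i \<Longrightarrow> (x, y) \<in> T \<longleftrightarrow> (x, y) \<in> L i i"
  by (metis P_disjoint T_E T_def UN_I)

lemma L_subset_T: "i \<in> {1..k} \<Longrightarrow> L i i \<subseteq> T"
  by (auto simp: T_def)

lemma T_subset: "T \<subseteq> V \<times> V"
proof clarify
  fix x y assume "(x, y) \<in> T"
  then show "x \<in> V \<and> y \<in> V" using P_subset_V by (blast elim: T_E)
qed

lemma finite_T: "finite T"
  using T_subset finite_V by (meson finite_SigmaI finite_subset)

lemma trans_T: "trans T"
proof (rule transI)
  fix x y z assume "(x, y) \<in> T" "(y, z) \<in> T"
  then obtain i where "i \<in> {1..k}" "x \<in> P i" "y \<in> P i" "(x, y) \<in> L i i" "(y, z) \<in> L i i"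
    by (metis T_E T_iff)
  then show "(x, z) \<in> T"
    using linear_orderD(2)[OF linear_L] L_subset_T by (meson subsetD transD)
qed

lemma antisym_T: "antisym T"
proof (rule antisymI)
  fix x y assume "(x, y) \<in> T" "(y, x) \<in> T"
  then obtain i where "i \<in> {1..k}" "(x, y) \<in> L i i" "(y, x) \<in> L i i"
    by (metis T_E T_iff)
  then show "x = y"
    using linear_orderD(3)[OF linear_L] by (meson antisymD)
qed

lemma refl_T: "x \<in> V \<Longrightarrow> (x, x) \<in> T"
  using Union_P linear_orderD(4)[OF linear_L] L_subset_T by blast

lemma refl_T2: "(x, y) \<in> T \<Longrightarrow> (x, x) \<in> T \<and> (y, y) \<in> T"
  using T_subset refl_T by blast

lemma total_T: "i \<in> {1..k} \<Longrightarrow> x \<in> P i \<Longrightarrow> y \<in> P i \<Longrightarrow> (x, y) \<in> T \<or> (y, x) \<in> T"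
  using linear_orderD(5)[OF linear_L] L_subset_T by blast

lemma T_path: "(x, y) \<in> T \<Longrightarrow> (covers T)\<^sup>*\<^sup>* x y"
  using rtranclp_covers[OF finite_T trans_T antisym_T] refl_T2 by blast

lemma const_on_convex:
  assumes X: "convex_in T X" "X \<subseteq> P i" "i \<in> {1..k}" "x \<in> X" "x' \<in> X"
    and step: "\<And>u v. u \<in> X \<Longrightarrow> v \<in> X \<Longrightarrow> covers T u v \<Longrightarrow> f u = f v"
  shows "f x = f x'"
proof -
  have path: "f x = f x'" if "x \<in> X" "x' \<in> X" "(x, x') \<in> T" for x x'
    by (rule covers_path_const[OF finite_T trans_T antisym_T _ X(1) that step]) (rule refl_T2)
  show ?thesis
    using path[of x x'] path[of x' x] total_T[OF X(3), of x x'] X by force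
qed

lemma window_subset:
  assumes "i \<in> {1..k}" "x \<in> P i"
  shows "window T x \<subseteq> P i"
proof
  fix y assume "y \<in> window T x"
  then have "y = x \<or> (x, y) \<in> L i i"
    using T_iff[OF assms(1)] assms(2) by (auto simp: window_def covers_def)
  then show "y \<in> P i"
    using linear_orderD(1)[OF linear_L[OF assms(1)]] assms(2) by blast
qed

text \<open>\<open>aligned\<close> fixes the order that a block induces on a class only up to
  reversal.\<close>

definition orientation :: "nat \<Rightarrow> 'a rel \<Rightarrow> bool" where
  "orientation i r \<longleftrightarrow> r = L i i \<or> r = (L i i)\<inverse>"

lemma linear_orientation: "i \<in> {1..k} \<Longrightarrow> orientation i r \<Longrightarrow> linear_order_on (P i) r"
  using linear_L by (auto simp: orientation_def)

text \<open>Windows look forward along \<open>L i i\<close> even if \<open>r\<close> is its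
  converse. Separation survives the reversal because it is symmetric in the two windows.\<close>

lemma windows_sep_T:
  assumes i: "i \<in> {1..k}" and r: "orientation i r" and x: "(x, x') \<in> r" "x \<noteq> x'"
    and a: "a \<in> window T x" "a' \<in> window T x'"
  shows "(a, a') \<in> r"
proof -
  note sep = windows_sep[OF linear_L[OF i] L_subset_T[OF i]]
  have A: "(x, y) \<in> L i i" if "x \<in> P i" "(x, y) \<in> T" for x y
    using that T_iff[OF i] by blast
  show ?thesis
    using r sep[of x x' a a'] sep[of x' x a' a] A x a by (auto simp: orientation_def)
qed

section \<open>Adjacency in a block, determined by two staircases\<close>

definition describes :: "nat \<Rightarrow> nat \<Rightarrow> ('a \<Rightarrow> 'a \<Rightarrow> bool) \<Rightarrow> ('a \<Rightarrow> 'a \<Rightarrow> bool) \<Rightarrow> bool" where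
  "describes i j h g \<longleftrightarrow> (\<forall>a\<in>P i. \<forall>a'\<in>P i. \<forall>b\<in>P j. \<forall>b'\<in>P j. a \<noteq> b \<longrightarrow> a' \<noteq> b' \<longrightarrow>
    h a b = h a' b' \<longrightarrow> g a b = g a' b' \<longrightarrow> ({a, b} \<in> E \<longleftrightarrow> {a', b'} \<in> E))"

text \<open>By (b) and (c), a pair in \<open>F i j\<close> stays in \<open>F i j\<close> when its
  ends move towards each other in \<open>L i j\<close>. The pairs outside \<open>F i j\<close> thus
  form two regions, one for each order of the ends, that are closed under moving the ends
  apart.\<close>

lemma staircases_ordered:
  assumes ij: "1 \<le> i" "i \<le> j" "j \<le> k"
  obtains r s h g where "orientation i r" "orientation j s" "staircase r s h" "staircase r s g"
    "describes i j h g"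
proof
  note w = pair_witness[OF ij]
  note d = linear_orderD[OF w(1)]
  let ?r = "Restr (L i j) (P i)" and ?s = "Restr (L i j) (P j)"
  \<comment> \<open>\<open>?h\<close> is the region where \<open>x\<close> precedes
    \<open>y\<close>; \<open>?g\<close> is the complement of the region where \<open>y\<close>
    precedes \<open>x\<close>. The complement makes both closed in the same direction.\<close>
  let ?h = "\<lambda>x y. (x, y) \<in> L i j \<and> x \<noteq> y \<and> {x, y} \<notin> F i j"
  let ?g = "\<lambda>x y. \<not> ((y, x) \<in> L i j \<and> x \<noteq> y \<and> {x, y} \<notin> F i j)"
  show "orientation i ?r" "orientation j ?s"
    using w(3,4) by (auto simp: orientation_def aligned_def)
  show "staircase ?r ?s ?h"
    unfolding staircase_def
  proof (intro allI impI)
    fix a a' b b' assume a: "(a, a') \<in> ?r" "(b', b) \<in> ?s" "?h a' b'"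
    then have le: "(a, a') \<in> L i j" "(a', b') \<in> L i j" "(b', b) \<in> L i j" "a' \<noteq> b'"
      and mem: "a \<in> P i" "a' \<in> P i" "b \<in> P j" "b' \<in> P j" and nF: "{a', b'} \<notin> F i j"
      by auto
    have lt: "(a, b') \<in> L i j" "(a', b) \<in> L i j" "(a, b) \<in> L i j" "a' \<noteq> b" "a \<noteq> b" "a \<noteq> b'"
      using le d(2,3) by (meson transD antisymD)+
    have "{a, b} \<notin> F i j"
    proof
      assume "{a, b} \<in> F i j"
      \<comment> \<open>The ends of the wider pair are moved inwards one at a time, by (b) and then
        by (c).\<close>
      then have "{a', b} \<in> F i j"
        using w(5)[of a a' b] le lt mem by (cases "a = a'") auto
      then have "{a', b'} \<in> F i j"
        using w(6)[of b' b a'] le lt mem by (cases "b = b'") auto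
      then show False using nF by simp
    qed
    then show "?h a b" using lt by simp
  qed
  show "staircase ?r ?s ?g"
    unfolding staircase_def
  proof (intro allI impI)
    fix a a' b b' assume a: "(a, a') \<in> ?r" "(b', b) \<in> ?s" "?g a' b'"
    show "?g a b"
    proof
      assume c: "(b, a) \<in> L i j \<and> a \<noteq> b \<and> {a, b} \<notin> F i j"
      then have le: "(a, a') \<in> L i j" "(b, a) \<in> L i j" "(b', b) \<in> L i j" "a \<noteq> b"
        and mem: "a \<in> P i" "a' \<in> P i" "b \<in> P j" "b' \<in> P j"
        using a by auto
      have lt: "(b', a) \<in> L i j" "(b, a') \<in> L i j" "(b', a') \<in> L i j" "a' \<noteq> b" "a \<noteq> b'" "a' \<noteq> b'"
        using le d(2,3) by (meson transD antisymD)+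
      then have "{b', a'} \<in> F i j"
        using a(3) by (auto simp: insert_commute)
      then have "{b, a'} \<in> F i j"
        using w(5)[of b' b a'] le lt mem by (cases "b = b'") auto
      then have "{b, a} \<in> F i j"
        using w(6)[of a a' b] le lt mem by (cases "a = a'") auto
      then show False using c by (simp add: insert_commute)
    qed
  qed
  have key: "{a, b} \<in> F i j \<longleftrightarrow> \<not> ?h a b \<and> ?g a b" if "a \<in> P i" "b \<in> P j" "a \<noteq> b" for a b
    using d(5)[of a b] that by auto
  have "{a, b} \<in> all_pairs V" if "a \<in> P i" "b \<in> P j" "a \<noteq> b" for a b
    using that P_subset_V[of i] P_subset_V[of j] ij by (auto simp: all_pairs_def)
  \<comment> \<open>Whether \<open>F i j\<close> is \<open>E\<close> or its complement, membership
    in it determines adjacency.\<close>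
  then have E: "{a, b} \<in> E \<longleftrightarrow> ({a, b} \<in> F i j) = (F i j = E)"
    if "a \<in> P i" "b \<in> P j" "a \<noteq> b" for a b
    using w(2) that by auto
  show "describes i j ?h ?g"
    unfolding describes_def
  proof (intro ballI impI)
    fix a a' b b' assume m: "a \<in> P i" "a' \<in> P i" "b \<in> P j" "b' \<in> P j" "a \<noteq> b" "a' \<noteq> b'"
      and "?h a b = ?h a' b'" "?g a b = ?g a' b'"
    then have "{a, b} \<in> F i j \<longleftrightarrow> {a', b'} \<in> F i j"
      using key[OF m(1,3,5)] key[OF m(2,4,6)] by argo
    then show "{a, b} \<in> E \<longleftrightarrow> {a', b'} \<in> E"
      using E m by simp
  qed
qed

text \<open>For \<open>i > j\<close> the block is a transpose. Transposing swaps the directions in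
  which a staircase is closed, and negation swaps them back.\<close>

lemma staircases:
  assumes "i \<in> {1..k}" "j \<in> {1..k}"
  obtains r s h g where "orientation i r" "orientation j s" "staircase r s h" "staircase r s g"
    "describes i j h g"
proof (cases "i \<le> j")
  case True
  then show ?thesis using staircases_ordered[of i j] assms that by auto
next
  case False
  then obtain r s h g where *: "orientation j r" "orientation i s" "staircase r s h" "staircase r s g"
    "describes j i h g"
    using staircases_ordered[of j i] assms by (metis atLeastAtMost_iff nat_le_linear)
  show ?thesis
  proof (rule that[of s r "\<lambda>x y. \<not> h y x" "\<lambda>x y. \<not> g y x"])
    show "staircase s r (\<lambda>x y. \<not> h y x)" "staircase s r (\<lambda>x y. \<not> g y x)"
      using *(3,4) unfolding staircase_def by blast+
    show "describes i j (\<lambda>x y. \<not> h y x) (\<lambda>x y. \<not> g y x)"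
      unfolding describes_def
    proof (intro ballI impI)
      fix a a' b b' assume "a \<in> P i" "a' \<in> P i" "b \<in> P j" "b' \<in> P j" "a \<noteq> b" "a' \<noteq> b'"
        "(\<not> h b a) = (\<not> h b' a')" "(\<not> g b a) = (\<not> g b' a')"
      then have "{b, a} \<in> E \<longleftrightarrow> {b', a'} \<in> E"
        using *(5)[unfolded describes_def, rule_format, of b b' a a'] by auto
      then show "{a, b} \<in> E \<longleftrightarrow> {a', b'} \<in> E"
        by (simp add: insert_commute)
    qed
  qed (use * in auto)
qed

text \<open>If neither staircase splits the pair, both are constant on it, and so is adjacency off
  the diagonal.\<close>

lemma mixed_splits:
  assumes "describes i j h g" "A \<subseteq> P i" "B \<subseteq> P j" "mixed E A B"
  shows "splits h A B \<or> splits g A B"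
proof (rule ccontr)
  assume n: "\<not> ?thesis"
  obtain a b a' b' where ab: "a \<in> A" "b \<in> B" "a \<noteq> b" "{a, b} \<in> E"
    "a' \<in> A" "b' \<in> B" "a' \<noteq> b'" "{a', b'} \<notin> E"
    using assms(4) unfolding mixed_def by blast
  have "h a b = h a' b'" "g a b = g a' b'"
    using n ab unfolding splits_def by blast+
  then show False
    using assms(1-3) ab unfolding describes_def by blast
qed

section \<open>Partitions into intervals and the number of touched pairs\<close>

definition parts :: "'a set set \<Rightarrow> bool" where
  "parts \<P> \<longleftrightarrow> partition_on V \<P> \<and> (\<forall>X\<in>\<P>. convex_in T X \<and> (\<exists>i\<in>{1..k}. X \<subseteq> P i))"

definition parts_of :: "'a set set \<Rightarrow> nat \<Rightarrow> 'a set set" where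
  "parts_of \<P> i = {X \<in> \<P>. X \<subseteq> P i}"

lemma partsD:
  assumes "parts \<P>"
  shows "finite \<P>" "\<And>X. X \<in> \<P> \<Longrightarrow> X \<noteq> {}" "\<And>X. X \<in> \<P> \<Longrightarrow> X \<subseteq> V" "\<Union>\<P> = V"
    "\<And>X Y x. X \<in> \<P> \<Longrightarrow> Y \<in> \<P> \<Longrightarrow> x \<in> X \<Longrightarrow> x \<in> Y \<Longrightarrow> X = Y"
    "\<And>X. X \<in> \<P> \<Longrightarrow> convex_in T X" "\<And>X. X \<in> \<P> \<Longrightarrow> \<exists>i\<in>{1..k}. X \<subseteq> P i"
proof -
  have p: "partition_on V \<P>" using assms by (simp add: parts_def)
  show "finite \<P>" using finite_elements[OF finite_V p] .
  show "X \<noteq> {}" "X \<subseteq> V" if "X \<in> \<P>" for X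
    using p that by (auto simp: partition_on_def)
  show "\<Union>\<P> = V" using p by (simp add: partition_on_def)
  show "X = Y" if "X \<in> \<P>" "Y \<in> \<P>" "x \<in> X" "x \<in> Y" for X Y x
    using p that unfolding partition_on_def disjoint_def by blast
  show "convex_in T X" "\<exists>i\<in>{1..k}. X \<subseteq> P i" if "X \<in> \<P>" for X
    using assms that by (auto simp: parts_def)
qed

lemma parts_of_card:
  assumes "parts \<P>"
  shows "(\<Sum>i\<in>{1..k}. card (parts_of \<P> i)) = card \<P>"
proof -
  note d = partsD[OF assms]
  have "(\<Sum>i\<in>{1..k}. card (parts_of \<P> i)) = card (\<Union>i\<in>{1..k}. parts_of \<P> i)"
  proof (rule card_UN_disjoint[symmetric])
    show "\<forall>i\<in>{1..k}. finite (parts_of \<P> i)"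
      using d(1) by (simp add: parts_of_def)
    show "\<forall>i\<in>{1..k}. \<forall>j\<in>{1..k}. i \<noteq> j \<longrightarrow> parts_of \<P> i \<inter> parts_of \<P> j = {}"
      using d(2) P_disjoint unfolding parts_of_def by blast
  qed simp
  also have "(\<Union>i\<in>{1..k}. parts_of \<P> i) = \<P>"
    using d(7) by (auto simp: parts_of_def)
  finally show ?thesis .
qed

text \<open>An arbitrary representative is enough to order the parts:
  \<open>part_order_elements\<close> shows that all elements of two parts compare in the same
  way.\<close>

definition rep :: "'a set \<Rightarrow> 'a" where
  "rep X = (SOME x. x \<in> X)"

definition part_order :: "'a set set \<Rightarrow> nat \<Rightarrow> 'a rel \<Rightarrow> 'a set rel" where
  "part_order \<P> i r = {(X, Y). X \<in> parts_of \<P> i \<and> Y \<in> parts_of \<P> i \<and> (rep X, rep Y) \<in> r}"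

lemma rep_in: "parts \<P> \<Longrightarrow> X \<in> \<P> \<Longrightarrow> rep X \<in> X"
  unfolding rep_def using partsD(2) some_in_eq by blast

lemma linear_part_order:
  assumes \<P>: "parts \<P>" and i: "i \<in> {1..k}" and r: "orientation i r"
  shows "linear_order_on (parts_of \<P> i) (part_order \<P> i r)"
proof -
  note d = linear_orderD[OF linear_orientation[OF i r]]
  have rep: "rep X \<in> X" "rep X \<in> P i" if "X \<in> parts_of \<P> i" for X
    using rep_in[OF \<P>, of X] that by (auto simp: parts_of_def)
  have inj: "X = Y" if "X \<in> parts_of \<P> i" "Y \<in> parts_of \<P> i" "rep X = rep Y" for X Y
    using rep[of X] rep[of Y] that partsD(5)[OF \<P>] unfolding parts_of_def by force
  show ?thesis
    unfolding order_on_defs refl_on_def total_on_def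
  proof (intro conjI ballI impI)
    show "part_order \<P> i r \<subseteq> parts_of \<P> i \<times> parts_of \<P> i"
      by (auto simp: part_order_def)
    show "(X, X) \<in> part_order \<P> i r" if "X \<in> parts_of \<P> i" for X
      using that d(4) rep by (simp add: part_order_def)
    show "trans (part_order \<P> i r)"
      using d(2) unfolding part_order_def by (auto intro!: transI dest: transD)
    show "antisym (part_order \<P> i r)"
      using d(3) inj unfolding part_order_def by (auto intro!: antisymI dest: antisymD)
    show "(X, Y) \<in> part_order \<P> i r \<or> (Y, X) \<in> part_order \<P> i r"
      if "X \<in> parts_of \<P> i" "Y \<in> parts_of \<P> i" for X Y
      using that d(5) rep by (simp add: part_order_def)
  qed
qed

text \<open>Parts are disjoint and convex. If \<open>y\<close> preceded \<open>x\<close>, then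
  either \<open>y\<close> would lie between \<open>rep X\<close> and \<open>x\<close>, or
  \<open>rep X\<close> between \<open>y\<close> and \<open>rep Y\<close>.\<close>

lemma part_order_elements:
  assumes \<P>: "parts \<P>" and i: "i \<in> {1..k}" and r: "orientation i r"
    and X: "(X, Y) \<in> part_order \<P> i r" "X \<noteq> Y" and x: "x \<in> X" "y \<in> Y"
  shows "(x, y) \<in> r" "x \<noteq> y"
proof -
  note d = linear_orderD[OF linear_orientation[OF i r]]
  have XY: "X \<in> \<P>" "Y \<in> \<P>" "X \<subseteq> P i" "Y \<subseteq> P i" "(rep X, rep Y) \<in> r"
    using X by (auto simp: part_order_def parts_of_def)
  note rep = rep_in[OF \<P> XY(1)] rep_in[OF \<P> XY(2)]
  have conv: "v \<in> Z" if "Z \<in> \<P>" "Z \<subseteq> P i" "u \<in> Z" "w \<in> Z" "(u, v) \<in> r" "(v, w) \<in> r" for Z u v w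
    using that partsD(6)[OF \<P>, of Z] L_subset_T[OF i] r
    unfolding convex_in_def orientation_def by blast
  have disj: "\<And>v. v \<in> X \<Longrightarrow> v \<notin> Y"
    using partsD(5)[OF \<P>] XY X(2) by blast
  show "x \<noteq> y" using disj x by blast
  show "(x, y) \<in> r"
  proof (rule ccontr)
    assume "(x, y) \<notin> r"
    then have yx: "(y, x) \<in> r" using d(5) x XY by blast
    have "rep X \<in> P i" "y \<in> P i" using rep XY x by auto
    then consider "(rep X, y) \<in> r" | "(y, rep X) \<in> r" using d(5) by blast
    then show False
    proof cases
      case 1
      then show False using conv[OF XY(1,3) rep(1) x(1) _ yx] disj x by blast
    next
      case 2
      then show False using conv[OF XY(2,4) x(2) rep(2) _ XY(5)] disj rep by blast
    qed
  qed
qed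

text \<open>If \<open>x < x'\<close> and \<open>z' < z\<close>, then no staircase splits both the pair of windows at \<open>(x, z)\<close> and the one at
  \<open>(x', z')\<close>; hence the parts that it splits form a chain.\<close>

lemma staircase_card_le:
  assumes \<P>: "parts \<P>" and i: "i \<in> {1..k}" and j: "j \<in> {1..k}"
    and r: "orientation i r" and s: "orientation j s" and h: "staircase r s h"
  shows "card {(X, Z). X \<in> parts_of \<P> i \<and> Z \<in> parts_of \<P> j \<and>
      (\<exists>x\<in>X. \<exists>z\<in>Z. splits h (window T x) (window T z))} \<le> card (parts_of \<P> i) + card (parts_of \<P> j)"
    (is "card ?R \<le> _")
proof (rule chain_card_le[OF linear_part_order[OF \<P> i r] linear_part_order[OF \<P> j s]])
  show "finite (parts_of \<P> i)" "finite (parts_of \<P> j)"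
    using partsD(1)[OF \<P>] by (auto simp: parts_of_def)
  show "?R \<subseteq> parts_of \<P> i \<times> parts_of \<P> j" by auto
  fix X Z X' Z'
  assume R: "(X, Z) \<in> ?R" "(X', Z') \<in> ?R" and X: "(X, X') \<in> part_order \<P> i r" "X \<noteq> X'"
  show "(Z, Z') \<in> part_order \<P> j s"
  proof (rule ccontr)
    assume n: "(Z, Z') \<notin> part_order \<P> j s"
    then have Z: "(Z', Z) \<in> part_order \<P> j s" "Z' \<noteq> Z"
      using linear_orderD(4,5)[OF linear_part_order[OF \<P> j s]] R by blast+
    obtain x z x' z' where m: "x \<in> X" "z \<in> Z" "x' \<in> X'" "z' \<in> Z'"
      "splits h (window T x) (window T z)" "splits h (window T x') (window T z')"
      using R by blast
    have "(a, a') \<in> r" if "a \<in> window T x" "a' \<in> window T x'" for a a'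
      using windows_sep_T[OF i r part_order_elements[OF \<P> i r X m(1,3)]] that .
    moreover have "(b', b) \<in> s" if "b' \<in> window T z'" "b \<in> window T z" for b b'
      using windows_sep_T[OF j s part_order_elements[OF \<P> j s Z m(4,2)]] that .
    \<comment> \<open>One value \<open>True\<close> of \<open>h\<close> on the windows at
      \<open>(x', z')\<close> forces \<open>True\<close> everywhere on the windows at
      \<open>(x, z)\<close>.\<close>
    ultimately show False
      using m(5,6) staircaseD[OF h] unfolding splits_def by blast
  qed
qed

text \<open>A window may stick out of its part by one vertex. The chain bound tolerates this, since
  windows at different vertices are still weakly ordered.\<close>

definition meets :: "'a set \<Rightarrow> 'a set \<Rightarrow> bool" where
  "meets X Z \<longleftrightarrow> (\<exists>x\<in>X. \<exists>z\<in>Z. mixed E (window T x) (window T z))"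

text \<open>All \<open>k * k\<close> ordered pairs of classes are summed, each with two staircases;
  every class occurs \<open>k\<close> times as a row class and \<open>k\<close> times as a column
  class, which gives the factor \<open>2 * 2 * k\<close>.\<close>

lemma meets_card_le:
  assumes \<P>: "parts \<P>"
  shows "card {(X, Z). X \<in> \<P> \<and> Z \<in> \<P> \<and> meets X Z} \<le> 4 * k * card \<P>"
proof -
  note d = partsD[OF \<P>]
  define R where "R = (\<lambda>i j. {(X, Z). X \<in> parts_of \<P> i \<and> Z \<in> parts_of \<P> j \<and> meets X Z})"
  have fin: "finite (R i j)" for i j
    by (rule finite_subset[of _ "\<P> \<times> \<P>"]) (auto simp: R_def parts_of_def d(1))
  have R: "card (R i j) \<le> 2 * card (parts_of \<P> i) + 2 * card (parts_of \<P> j)"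
    if ij: "i \<in> {1..k}" "j \<in> {1..k}" for i j
  proof -
    obtain r s h g where rs: "orientation i r" "orientation j s" and hg: "staircase r s h" "staircase r s g"
      and desc: "describes i j h g"
      using staircases[OF ij] .
    let ?R = "\<lambda>h. {(X, Z). X \<in> parts_of \<P> i \<and> Z \<in> parts_of \<P> j \<and>
      (\<exists>x\<in>X. \<exists>z\<in>Z. splits h (window T x) (window T z))}"
    have "R i j \<subseteq> ?R h \<union> ?R g"
    proof (rule subrelI)
      fix X Z assume "(X, Z) \<in> R i j"
      then obtain x z where xz: "x \<in> X" "z \<in> Z" "mixed E (window T x) (window T z)"
        and m: "X \<in> parts_of \<P> i" "Z \<in> parts_of \<P> j"
        by (auto simp: R_def meets_def)
      have "X \<subseteq> P i" "Z \<subseteq> P j" using m by (auto simp: parts_of_def)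
      then have "window T x \<subseteq> P i" "window T z \<subseteq> P j"
        using window_subset ij xz(1,2) by blast+
      then have "splits h (window T x) (window T z) \<or> splits g (window T x) (window T z)"
        using xz(3) by (rule mixed_splits[OF desc])
      then show "(X, Z) \<in> ?R h \<union> ?R g"
        using xz m by blast
    qed
    moreover have "finite (?R h)" "finite (?R g)"
      by (rule finite_subset[of _ "\<P> \<times> \<P>"]; auto simp: parts_of_def d(1))+
    ultimately have "card (R i j) \<le> card (?R h) + card (?R g)"
      by (meson card_Un_le card_mono finite_UnI le_trans)
    then show ?thesis
      using staircase_card_le[OF \<P> ij rs hg(1)] staircase_card_le[OF \<P> ij rs hg(2)] by linarith
  qed
  have "{(X, Z). X \<in> \<P> \<and> Z \<in> \<P> \<and> meets X Z} = (\<Union>i\<in>{1..k}. \<Union>j\<in>{1..k}. R i j)"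
  proof (intro equalityI subsetI; clarify)
    fix X Z assume "X \<in> \<P>" "Z \<in> \<P>" "meets X Z"
    then show "(X, Z) \<in> (\<Union>i\<in>{1..k}. \<Union>j\<in>{1..k}. R i j)"
      using d(7)[of X] d(7)[of Z] by (auto simp: R_def parts_of_def)
  qed (auto simp: R_def parts_of_def)
  also have "card \<dots> \<le> (\<Sum>i\<in>{1..k}. card (\<Union>j\<in>{1..k}. R i j))"
    by (rule card_UN_le) simp
  also have "\<dots> \<le> (\<Sum>i\<in>{1..k}. \<Sum>j\<in>{1..k}. card (R i j))"
    by (intro sum_mono card_UN_le) simp
  also have "\<dots> \<le> (\<Sum>i\<in>{1..k}. \<Sum>j\<in>{1..k}. 2 * card (parts_of \<P> i) + 2 * card (parts_of \<P> j))"
    by (intro sum_mono R)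
  also have "\<dots> = 4 * k * card \<P>"
    by (simp add: sum.distrib sum_distrib_left[symmetric] parts_of_card[OF \<P>, simplified])
  finally show ?thesis .
qed

end

section \<open>Mergeable parts\<close>

text \<open>\<open>cuts\<close> refers to single vertices and not to the partition. Hence a part
  that counts after the merge is the image of one that counted before.\<close>

lemma cut_degree_merge_le:
  assumes "finite \<P>" "X \<in> \<P>" "Y \<in> \<P>"
  shows "cut_degree E T (insert (X \<union> Y) (\<P> - {X, Y})) U \<le> cut_degree E T \<P> U"
proof -
  let ?S = "{Z \<in> \<P>. \<exists>z\<in>Z. cuts E T U z}"
  have "{Z \<in> insert (X \<union> Y) (\<P> - {X, Y}). \<exists>z\<in>Z. cuts E T U z} \<subseteq>
      (\<lambda>Z. if Z = X \<or> Z = Y then X \<union> Y else Z) ` ?S"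
    using assms(2,3) by (auto simp: image_iff)
  then show ?thesis
    unfolding cut_degree_def using assms(1) by (elim surj_card_le[rotated]) simp
qed

text \<open>\<open>X\<close> and \<open>Y\<close> both count for \<open>X \<union> Y\<close>, as
  they lie inside it, and they become a single part.\<close>

lemma cut_degree_merged:
  assumes "finite \<P>" "X \<in> \<P>" "Y \<in> \<P>" "X \<noteq> Y" "X \<noteq> {}" "Y \<noteq> {}"
  shows "Suc (cut_degree E T (insert (X \<union> Y) (\<P> - {X, Y})) (X \<union> Y)) \<le> cut_degree E T \<P> (X \<union> Y)"
proof -
  let ?S = "{Z \<in> \<P>. \<exists>z\<in>Z. cuts E T (X \<union> Y) z}"
  have S: "X \<in> ?S" "Y \<in> ?S" "finite ?S"
    using assms by (auto simp: cuts_def)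
  have "{Z \<in> insert (X \<union> Y) (\<P> - {X, Y}). \<exists>z\<in>Z. cuts E T (X \<union> Y) z} \<subseteq> insert (X \<union> Y) (?S - {X, Y})"
    by auto
  then have "card {Z \<in> insert (X \<union> Y) (\<P> - {X, Y}). \<exists>z\<in>Z. cuts E T (X \<union> Y) z} \<le>
      card (insert (X \<union> Y) (?S - {X, Y}))"
    using S(3) by (intro card_mono) auto
  also have "\<dots> \<le> Suc (card (?S - {X, Y}))"
    using S(3) by (simp add: card_insert_if)
  finally have "card {Z \<in> insert (X \<union> Y) (\<P> - {X, Y}). \<exists>z\<in>Z. cuts E T (X \<union> Y) z} \<le>
      Suc (card (?S - {X, Y}))" .
  moreover have "card (?S - {X, Y}) = card ?S - 2"
    using S assms(4) by (subst card_Diff_subset) auto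
  moreover have "card {X, Y} \<le> card ?S"
    using S by (intro card_mono) auto
  ultimately show ?thesis
    using assms(4) unfolding cut_degree_def by simp
qed

context mixed_thin
begin

text \<open>If no pair of windows is mixed, every row of \<open>U\<close> is constant on the window
  of \<open>z\<close>, and the column of \<open>z\<close> is constant along consecutive vertices of
  \<open>U\<close>, hence on all of \<open>U\<close>.\<close>

lemma cut_convex_mixed:
  assumes i: "i \<in> {1..k}" and U: "convex_in T U" "U \<subseteq> P i" and z: "z \<notin> U" "cuts E T U z"
  shows "\<exists>x\<in>U. mixed E (window T x) (window T z)"
proof (rule ccontr)
  assume n: "\<not> ?thesis"
  have z_window: "z \<in> window T z" and window_self: "\<And>u. u \<in> window T u" by (auto simp: window_def)
  \<comment> \<open>Rows are compared through the column \<open>z\<close>, which has no diagonal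
    entry in \<open>U\<close>; the successor of \<open>z\<close> may lie in
    \<open>U\<close>.\<close>
  have near: "{a, b} \<in> E \<longleftrightarrow> {a, z} \<in> E" if "a \<in> U" "b \<in> window T z" "a \<noteq> b" for a b
    using n that z(1) z_window window_self unfolding mixed_def by metis
  obtain a b a' b' where ab: "a \<in> U" "b \<in> window T z" "a \<noteq> b" "{a, b} \<in> E"
    "a' \<in> U" "b' \<in> window T z" "a' \<noteq> b'" "{a', b'} \<notin> E"
    using z unfolding cuts_def mixed_def by blast
  have step: "({u, z} \<in> E) = ({v, z} \<in> E)" if "u \<in> U" "v \<in> U" "covers T u v" for u v
  proof -
    have "u \<in> window T u" "v \<in> window T u" "u \<noteq> z" "v \<noteq> z"
      using that z(1) by (auto simp: window_def)
    then show ?thesis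
      using n that(1) z_window unfolding mixed_def by metis
  qed
  have "({a, z} \<in> E) = ({a', z} \<in> E)"
    by (rule const_on_convex[OF U i ab(1,5), of "\<lambda>u. {u, z} \<in> E"]) (rule step)
  then show False using near ab by blast
qed

text \<open>Links red entries to \<open>cut_degree\<close>. If nothing in \<open>Y\<close> is cut,
  each row is constant along consecutive vertices of \<open>Y\<close>, and each column is constant
  on \<open>X\<close>. A red diagonal entry is covered by \<open>z \<in> U\<close>.\<close>

lemma nonconstant_cut:
  assumes \<P>: "parts \<P>" and XY: "X \<in> \<P>" "Y \<in> \<P>"
    and E: "\<exists>x\<in>X. \<exists>y\<in>Y. {x, y} \<in> E" "\<exists>x\<in>X. \<exists>y\<in>Y. {x, y} \<notin> E"
  shows "\<exists>z\<in>Y. cuts E T X z"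
proof (cases "X = Y")
  case True
  then show ?thesis using E by (auto simp: cuts_def)
next
  case False
  note d = partsD[OF \<P>]
  have disj: "\<And>x y. x \<in> X \<Longrightarrow> y \<in> Y \<Longrightarrow> x \<noteq> y"
    using d(5) XY False by blast
  show ?thesis
  proof (rule ccontr)
    assume n: "\<not> ?thesis"
    have self: "\<And>u. u \<in> window T u" by (simp add: window_def)
    obtain a b a' b' where ab: "a \<in> X" "b \<in> Y" "{a, b} \<in> E" "a' \<in> X" "b' \<in> Y" "{a', b'} \<notin> E"
      using E by blast
    have step: "({a, u} \<in> E) = ({a, v} \<in> E)" if "u \<in> Y" "v \<in> Y" "covers T u v" for u v
    proof -
      have "v \<in> window T u" using that by (auto simp: window_def)
      then show ?thesis
        using n that(1,2) ab(1) disj self unfolding cuts_def mixed_def by metis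
    qed
    obtain i where i: "i \<in> {1..k}" "Y \<subseteq> P i" using d(7) XY by blast
    have "({a, b} \<in> E) = ({a, b'} \<in> E)"
      by (rule const_on_convex[OF d(6)[OF XY(2)] i(2,1) ab(2,5), of "\<lambda>u. {a, u} \<in> E"]) (rule step)
    moreover have "({a, b'} \<in> E) = ({a', b'} \<in> E)"
    proof -
      have "\<not> mixed E X (window T b')" using n ab(5) by (auto simp: cuts_def)
      moreover have "a \<noteq> b'" "a' \<noteq> b'" using disj ab by auto
      ultimately show ?thesis
        using ab(1,4) self[of b'] unfolding mixed_def by blast
    qed
    ultimately show False using ab by blast
  qed
qed

section \<open>Consecutive parts and their unions\<close>

lemma adjacent_same_class:
  assumes \<P>: "parts \<P>" and XY: "X \<in> \<P>" "Y \<in> \<P>" "adjacent T X Y"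
  obtains i where "i \<in> {1..k}" "X \<subseteq> P i" "Y \<subseteq> P i"
proof -
  obtain x y where xy: "x \<in> X" "y \<in> Y" "(x, y) \<in> T"
    using XY(3) by (auto simp: adjacent_def covers_def)
  obtain i j where "i \<in> {1..k}" "X \<subseteq> P i" "j \<in> {1..k}" "Y \<subseteq> P j"
    using partsD(7)[OF \<P>] XY by metis
  then show ?thesis
    using that xy P_disjoint by (metis T_E subsetD)
qed

text \<open>Nothing lies strictly between the consecutive vertices \<open>x\<close> and
  \<open>y\<close>. A vertex of the class is therefore below \<open>x\<close> or above
  \<open>y\<close>, and convexity of one of the two parts applies.\<close>

lemma convex_union:
  assumes \<P>: "parts \<P>" and XY: "X \<in> \<P>" "Y \<in> \<P>" "adjacent T X Y"
  shows "convex_in T (X \<union> Y)"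
proof -
  obtain i where i: "i \<in> {1..k}" "X \<subseteq> P i" "Y \<subseteq> P i"
    using adjacent_same_class[OF assms] .
  obtain x y where xy: "x \<in> X" "y \<in> Y" "covers T x y"
    using XY(3) by (auto simp: adjacent_def)
  have conv: "v \<in> Z" if "Z \<in> \<P>" "u \<in> Z" "w \<in> Z" "(u, v) \<in> T" "(v, w) \<in> T" for Z u v w
    using that partsD(6)[OF \<P>, of Z] unfolding convex_in_def by blast
  have side: "(b, x) \<in> T \<or> (y, b) \<in> T" if "b \<in> P i" for b
    using that total_T[OF i(1)] xy i unfolding covers_def by blast
  have xyT: "(x, y) \<in> T" using xy by (simp add: covers_def)
  note tr = transD[OF trans_T]
  show ?thesis
    unfolding convex_in_def
  proof (intro ballI allI impI)
    fix a b c assume a: "a \<in> X \<union> Y" "c \<in> X \<union> Y" "(a, b) \<in> T" "(b, c) \<in> T"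
    then have "b \<in> P i" using i by (metis T_iff Un_iff T_E P_disjoint subsetD)
    then consider "(b, x) \<in> T" "(b, y) \<in> T" | "(y, b) \<in> T" "(x, b) \<in> T"
      using side xyT tr by blast
    then show "b \<in> X \<union> Y"
    proof cases
      case 1
      then show ?thesis using a conv[OF XY(1)] conv[OF XY(2)] xy by blast
    next
      case 2
      then show ?thesis using a conv[OF XY(1)] conv[OF XY(2)] xy by blast
    qed
  qed
qed

lemma parts_merge:
  assumes \<P>: "parts \<P>" and XY: "X \<in> \<P>" "Y \<in> \<P>" "X \<noteq> Y" "adjacent T X Y"
  shows "parts (insert (X \<union> Y) (\<P> - {X, Y}))"
proof -
  note d = partsD[OF \<P>]
  have "partition_on V (insert (X \<union> Y) (\<P> - {X, Y}))"
    unfolding partition_on_def disjoint_def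
  proof (intro conjI ballI impI)
    show "\<Union> (insert (X \<union> Y) (\<P> - {X, Y})) = V"
      using d(4) XY by blast
    show "{} \<notin> insert (X \<union> Y) (\<P> - {X, Y})"
      using d(2) XY by blast
    show "A \<inter> B = {}" if "A \<in> insert (X \<union> Y) (\<P> - {X, Y})" "B \<in> insert (X \<union> Y) (\<P> - {X, Y})" "A \<noteq> B" for A B
    proof -
      have disj: "Z \<inter> Z' = {}" if "Z \<in> \<P>" "Z' \<in> \<P>" "Z \<noteq> Z'" for Z Z'
        using d(5) that by blast
      show ?thesis
        using that XY(1,2) by (elim insertE DiffE) (simp_all add: Int_Un_distrib Int_Un_distrib2 disj disj[OF _ _ not_sym])
    qed
  qed
  moreover obtain i where "i \<in> {1..k}" "X \<subseteq> P i" "Y \<subseteq> P i"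
    using adjacent_same_class[OF \<P> XY(1,2,4)] .
  ultimately show ?thesis
    using convex_union[OF \<P> XY(1,2,4)] d(6,7) unfolding parts_def by auto
qed

text \<open>A path of successors from \<open>x\<close> to \<open>y\<close> has to leave
  \<open>X\<close>; the part entered at that step need not contain \<open>y\<close>.\<close>

lemma class_leaves_part:
  assumes \<P>: "parts \<P>" and X: "X \<in> \<P>" "x \<in> X" "y \<notin> X" "(x, y) \<in> T"
  shows "\<exists>Y\<in>\<P>. Y \<noteq> X \<and> adjacent T X Y"
proof -
  have "(covers T)\<^sup>*\<^sup>* x y"
    using X(4) by (rule T_path)
  then have "\<exists>u v. u \<in> X \<and> v \<notin> X \<and> covers T u v"
    using X(3,2) by (induction rule: rtranclp_induct) auto
  then obtain u v where uv: "u \<in> X" "v \<notin> X" "covers T u v" by blast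
  then have "v \<in> V" using T_subset by (auto simp: covers_def)
  then obtain Y where "Y \<in> \<P>" "v \<in> Y" using partsD(4)[OF \<P>] by blast
  then show ?thesis using uv by (auto simp: adjacent_def)
qed

text \<open>Makes the choice of a next part injective. If the exits \<open>x\<close> and
  \<open>x'\<close> differed, the later one would lie strictly between the earlier one and its
  successor, or inside the convex set \<open>Y\<close>.\<close>

lemma adjacent_unique:
  assumes \<P>: "parts \<P>" and X: "X \<in> \<P>" "X' \<in> \<P>" "Y \<in> \<P>" "X \<noteq> Y" "X' \<noteq> Y"
    and adj: "adjacent T X Y" "adjacent T X' Y"
  shows "X = X'"
proof -
  obtain i where i: "i \<in> {1..k}" "X \<subseteq> P i" "Y \<subseteq> P i"
    using adjacent_same_class[OF \<P> X(1,3) adj(1)] .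
  obtain j where j: "j \<in> {1..k}" "X' \<subseteq> P j" "Y \<subseteq> P j"
    using adjacent_same_class[OF \<P> X(2,3) adj(2)] .
  have "i = j" using i j partsD(2)[OF \<P> X(3)] P_disjoint by blast
  obtain x y where xy: "x \<in> X" "y \<in> Y" "covers T x y" using adj(1) by (auto simp: adjacent_def)
  obtain x' y' where xy': "x' \<in> X'" "y' \<in> Y" "covers T x' y'" using adj(2) by (auto simp: adjacent_def)
  have mem: "x \<in> P i" "x' \<in> P i" "y \<in> P i" "y' \<in> P i"
    using i j xy xy' \<open>i = j\<close> by auto
  have notin: "x \<notin> Y" "x' \<notin> Y"
    using partsD(5)[OF \<P>] X xy xy' by blast+
  have conv: "v \<in> Y" if "(y, v) \<in> T" "(v, y') \<in> T \<or> (v, y) \<in> T" for v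
    using that partsD(6)[OF \<P> X(3)] xy(2) xy'(2) unfolding convex_in_def by blast
  have conv': "v \<in> Y" if "(y', v) \<in> T" "(v, y') \<in> T \<or> (v, y) \<in> T" for v
    using that partsD(6)[OF \<P> X(3)] xy(2) xy'(2) unfolding convex_in_def by blast
  have "x = x'"
  proof (cases "(x, x') \<in> T")
    case True
    have "(x', y) \<in> T"
      using conv[of x'] notin xy'(3) total_T[OF i(1) mem(2,3)] by (auto simp: covers_def)
    then have "x' = x \<or> x' = y" using xy(3) True by (auto simp: covers_def)
    then show ?thesis using notin xy(2) by auto
  next
    case False
    then have "(x', x) \<in> T" using total_T[OF i(1) mem(1,2)] by simp
    have "(x, y') \<in> T"
      using conv'[of x] notin xy(3) total_T[OF i(1) mem(1,4)] by (auto simp: covers_def)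
    then have "x = x' \<or> x = y'" using xy'(3) \<open>(x', x) \<in> T\<close> by (auto simp: covers_def)
    then show ?thesis using notin xy'(2) by auto
  qed
  then show ?thesis using partsD(5)[OF \<P> X(1,2)] xy(1) xy'(1) by blast
qed

text \<open>At most one such part per class: of two parts of the same class, one has a vertex below
  a vertex of the other and is left by a path of successors.\<close>

lemma card_parts_without_successor:
  assumes \<P>: "parts \<P>"
  shows "card {X \<in> \<P>. \<not> (\<exists>Y\<in>\<P>. Y \<noteq> X \<and> adjacent T X Y)} \<le> k"
proof -
  let ?N = "{X \<in> \<P>. \<not> (\<exists>Y\<in>\<P>. Y \<noteq> X \<and> adjacent T X Y)}"
  have "\<forall>X\<in>\<P>. \<exists>i. i \<in> {1..k} \<and> X \<subseteq> P i" using partsD(7)[OF \<P>] by blast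
  then obtain idx where idx: "\<And>X. X \<in> \<P> \<Longrightarrow> idx X \<in> {1..k} \<and> X \<subseteq> P (idx X)"
    by metis
  have "inj_on idx ?N"
  proof (rule inj_onI)
    fix X Y assume XY: "X \<in> ?N" "Y \<in> ?N" "idx X = idx Y"
    then have m: "X \<in> \<P>" "Y \<in> \<P>" by auto
    obtain x y where xy: "x \<in> X" "y \<in> Y" using partsD(2)[OF \<P>] m by blast
    then have "(x, y) \<in> T \<or> (y, x) \<in> T"
      using total_T[of "idx X" x y] idx[OF m(1)] idx[OF m(2)] XY(3) by auto
    then show "X = Y"
      using class_leaves_part[OF \<P> m(1) xy(1), of y] class_leaves_part[OF \<P> m(2) xy(2), of x]
        XY(1,2) partsD(5)[OF \<P> m] xy by blast
  qed
  moreover have "idx ` ?N \<subseteq> {1..k}" using idx by blast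
  ultimately have "card ?N \<le> card {1..k}" by (intro card_inj_on_le) auto
  then show ?thesis by simp
qed

text \<open>The summand 2 stands for \<open>X\<close> and \<open>Y\<close> themselves. Any other
  part that counts meets \<open>X\<close> or \<open>Y\<close>, as \<open>X \<union> Y\<close> is
  convex.\<close>

lemma cut_degree_adjacent_le:
  assumes \<P>: "parts \<P>" and XY: "X \<in> \<P>" "Y \<in> \<P>" "adjacent T X Y"
  shows "cut_degree E T \<P> (X \<union> Y) \<le> card {Z \<in> \<P>. meets X Z} + card {Z \<in> \<P>. meets Y Z} + 2"
proof -
  obtain i where i: "i \<in> {1..k}" "X \<subseteq> P i" "Y \<subseteq> P i"
    using adjacent_same_class[OF \<P> XY] .
  have "{Z \<in> \<P>. \<exists>z\<in>Z. cuts E T (X \<union> Y) z} \<subseteq> {Z \<in> \<P>. meets X Z} \<union> {Z \<in> \<P>. meets Y Z} \<union> {X, Y}"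
  proof
    fix Z assume "Z \<in> {Z \<in> \<P>. \<exists>z\<in>Z. cuts E T (X \<union> Y) z}"
    then obtain z where Z: "Z \<in> \<P>" "z \<in> Z" "cuts E T (X \<union> Y) z" by blast
    show "Z \<in> {Z \<in> \<P>. meets X Z} \<union> {Z \<in> \<P>. meets Y Z} \<union> {X, Y}"
    proof (cases "z \<in> X \<union> Y")
      case True
      then show ?thesis using partsD(5)[OF \<P>] Z XY by blast
    next
      case False
      then obtain x where "x \<in> X \<union> Y" "mixed E (window T x) (window T z)"
        using cut_convex_mixed[OF i(1) convex_union[OF \<P> XY] _ False Z(3)] i by blast
      then show ?thesis using Z by (auto simp: meets_def)
    qed
  qed
  then have "cut_degree E T \<P> (X \<union> Y) \<le> card ({Z \<in> \<P>. meets X Z} \<union> {Z \<in> \<P>. meets Y Z} \<union> {X, Y})"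
    unfolding cut_degree_def using partsD(1)[OF \<P>] by (intro card_mono) auto
  also have "\<dots> \<le> card {Z \<in> \<P>. meets X Z} + card {Z \<in> \<P>. meets Y Z} + card {X, Y}"
    by (meson add_le_mono1 card_Un_le le_trans)
  also have "card {X, Y} \<le> 2" by (simp add: card_insert_if)
  finally show ?thesis by simp
qed

text \<open>The bound is \<open>9 * k + 1\<close> because \<open>X\<close> and \<open>Y\<close>
  still count as two parts; the merge brings it down to \<open>9 * k\<close>.\<close>

lemma mergeable_pair_exists:
  assumes k: "k \<ge> 1" and \<P>: "parts \<P>" and large: "9 * k < card \<P>"
  shows "\<exists>X\<in>\<P>. \<exists>Y\<in>\<P>. X \<noteq> Y \<and> adjacent T X Y \<and> cut_degree E T \<P> (X \<union> Y) \<le> 9 * k + 1"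
proof (rule ccontr)
  assume n: "\<not> ?thesis"
  note d = partsD[OF \<P>]
  let ?N = "{X \<in> \<P>. \<exists>Y\<in>\<P>. Y \<noteq> X \<and> adjacent T X Y}"
  obtain nxt where nxt: "\<And>X. X \<in> ?N \<Longrightarrow> nxt X \<in> \<P> \<and> nxt X \<noteq> X \<and> adjacent T X (nxt X)"
    using bchoice[of ?N "\<lambda>X Y. Y \<in> \<P> \<and> Y \<noteq> X \<and> adjacent T X Y"] by auto
  have inj: "inj_on nxt ?N"
  proof (rule inj_onI)
    fix X X' assume "X \<in> ?N" "X' \<in> ?N" "nxt X = nxt X'"
    then show "X = X'"
      using nxt[of X] nxt[of X'] adjacent_unique[OF \<P>, of X X' "nxt X"] by auto
  qed
  define H where "H = (\<lambda>X. card {Z \<in> \<P>. meets X Z})"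
  have "{(X, Z). X \<in> \<P> \<and> Z \<in> \<P> \<and> meets X Z} = Sigma \<P> (\<lambda>X. {Z \<in> \<P>. meets X Z})" by auto
  then have H: "sum H \<P> \<le> 4 * k * card \<P>"
    using meets_card_le[OF \<P>] d(1) by (simp add: H_def)
  \<comment> \<open>The degree is at least \<open>9 * k + 2\<close>, of which 2 is due to
    \<open>X\<close> and \<open>nxt X\<close> themselves.\<close>
  have "9 * k \<le> H X + H (nxt X)" if "X \<in> ?N" for X
  proof -
    have "\<not> cut_degree E T \<P> (X \<union> nxt X) \<le> 9 * k + 1" using n nxt[OF that] that by blast
    then show ?thesis
      using cut_degree_adjacent_le[OF \<P>, of X "nxt X"] nxt[OF that] that by (simp add: H_def)
  qed
  then have "card ?N * (9 * k) \<le> (\<Sum>X\<in>?N. H X + H (nxt X))"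
    using sum_bounded_below[of ?N "9 * k" "\<lambda>X. H X + H (nxt X)"] by simp
  also have "\<dots> = sum H ?N + sum H (nxt ` ?N)"
    by (simp add: sum.distrib sum.reindex[OF inj])
  \<comment> \<open>As \<open>nxt\<close> is injective, a part occurs at most once as
    \<open>X\<close> and at most once as \<open>nxt X\<close>.\<close>
  also have "\<dots> \<le> sum H \<P> + sum H \<P>"
    using nxt d(1) by (intro add_mono sum_mono2) auto
  also have "\<dots> \<le> 8 * k * card \<P>" using H by linarith
  finally have le: "card ?N * (9 * k) \<le> 8 * k * card \<P>" .
  let ?N' = "{X \<in> \<P>. \<not> (\<exists>Y\<in>\<P>. Y \<noteq> X \<and> adjacent T X Y)}"
  have "\<P> = ?N \<union> ?N'" by blast
  then have "card \<P> \<le> card ?N + card ?N'"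
    using card_Un_le[of ?N ?N'] by simp
  then have "card \<P> \<le> card ?N + k" using card_parts_without_successor[OF \<P>] by simp
  then have "card \<P> * (9 * k) \<le> (card ?N + k) * (9 * k)" by (rule mult_le_mono1)
  also have "\<dots> \<le> 8 * k * card \<P> + 9 * k * k" using le by (simp add: add_mult_distrib)
  finally have "k * card \<P> \<le> k * (9 * k)" by (simp add: algebra_simps)
  then show False using k large by simp
qed

section \<open>The initial partition into singletons\<close>

lemma parts_singletons: "parts ((\<lambda>x. {x}) ` V)"
proof -
  have "partition_on V ((\<lambda>x. {x}) ` V)"
    by (auto simp: partition_on_def disjoint_def)
  moreover have "convex_in T {x}" for x
    using antisym_T by (auto simp: convex_in_def dest: antisymD)
  ultimately show ?thesis using Union_P unfolding parts_def by auto
qed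

text \<open>Along a row a staircase changes its value once: a value \<open>True\<close> in the
  window at \<open>z\<close> forces \<open>True\<close> on all windows further on in
  \<open>s\<close>.\<close>

lemma row_splits_card_le:
  assumes x: "x \<in> P i" and i: "i \<in> {1..k}" and j: "j \<in> {1..k}"
    and r: "orientation i r" and s: "orientation j s" and h: "staircase r s h"
  shows "card {z \<in> P j. splits h {x} (window T z)} \<le> 1"
proof -
  have "(x, x) \<in> r" using linear_orderD(4)[OF linear_orientation[OF i r]] x .
  note mono = staircaseD[OF h this]
  have no: "\<not> (z, z') \<in> s" if "z \<noteq> z'" "splits h {x} (window T z)" "splits h {x} (window T z')" for z z'
    using that windows_sep_T[OF j s] mono unfolding splits_def by blast
  have "z = z'" if "z \<in> P j" "z' \<in> P j" "splits h {x} (window T z)" "splits h {x} (window T z')" for z z'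
    using no[of z z'] no[of z' z] that linear_orderD(5)[OF linear_orientation[OF j s], of z z'] by metis
  then show ?thesis
    using finite_P[OF j] by (subst card_le_Suc0_iff_eq[simplified One_nat_def[symmetric]]) auto
qed

text \<open>Each class contributes at most one vertex per staircase, and \<open>x\<close> counts for
  itself, so the degree is at most \<open>2 * k + 1\<close>.\<close>

lemma cut_degree_singletons:
  assumes k: "k \<ge> 1" and x: "x \<in> V"
  shows "cut_degree E T ((\<lambda>x. {x}) ` V) {x} \<le> 9 * k"
proof -
  obtain i where i: "i \<in> {1..k}" "x \<in> P i" using x Union_P by blast
  let ?S = "\<lambda>j. {z \<in> P j. mixed E {x} (window T z)}"
  have S: "card (?S j) \<le> 2" if j: "j \<in> {1..k}" for j
  proof -
    obtain r s h g where rs: "orientation i r" "orientation j s" and hg: "staircase r s h" "staircase r s g"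
      and desc: "describes i j h g"
      using staircases[OF i(1) j] .
    have "?S j \<subseteq> {z \<in> P j. splits h {x} (window T z)} \<union> {z \<in> P j. splits g {x} (window T z)}"
      using mixed_splits[OF desc, of "{x}"] window_subset[OF j] i(2) by blast
    then have "card (?S j) \<le> card ({z \<in> P j. splits h {x} (window T z)} \<union> {z \<in> P j. splits g {x} (window T z)})"
      using finite_P[OF j] by (intro card_mono) auto
    also have "\<dots> \<le> card {z \<in> P j. splits h {x} (window T z)} + card {z \<in> P j. splits g {x} (window T z)}"
      by (rule card_Un_le)
    also have "\<dots> \<le> 1 + 1"
      using row_splits_card_le[OF i(2,1) j rs] hg by (intro add_mono) auto
    finally show ?thesis by simp
  qed
  have fin: "finite (\<Union>j\<in>{1..k}. ?S j)" using finite_P by auto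
  have "{Z \<in> (\<lambda>x. {x}) ` V. \<exists>z\<in>Z. cuts E T {x} z} \<subseteq> (\<lambda>x. {x}) ` insert x (\<Union>j\<in>{1..k}. ?S j)"
    using Union_P by (auto simp: cuts_def)
  then have "cut_degree E T ((\<lambda>x. {x}) ` V) {x} \<le> card (insert x (\<Union>j\<in>{1..k}. ?S j))"
    unfolding cut_degree_def using fin by (intro surj_card_le) auto
  also have "\<dots> \<le> Suc (card (\<Union>j\<in>{1..k}. ?S j))" using fin by (simp add: card_insert_if)
  also have "\<dots> \<le> Suc (\<Sum>j\<in>{1..k}. card (?S j))" by (simp add: card_UN_le)
  also have "\<dots> \<le> Suc (\<Sum>j\<in>{1..k}. 2)" by (simp only: Suc_le_mono) (rule sum_mono, rule S)
  also have "\<dots> \<le> 9 * k" using k by simp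
  finally show ?thesis .
qed

end

section \<open>The greedy contraction sequence\<close>

text \<open>A part is represented by the list of its vertices; its row and column in the contracted matrix
  carry the name of the first one.\<close>

definition merge_parts :: "'a list \<Rightarrow> 'a list \<Rightarrow> 'a list list \<Rightarrow> 'a list list" where
  "merge_parts X Y ps = (X @ Y) # filter (\<lambda>Z. hd Z \<noteq> hd X \<and> hd Z \<noteq> hd Y) ps"

text \<open>The bound \<open>b\<close> will be \<open>9 * k + 2\<close>: the parts \<open>X\<close> and \<open>Y\<close> are counted separately, but become one part.\<close>

definition mergeable ::
  "'a set set \<Rightarrow> 'a rel \<Rightarrow> nat \<Rightarrow> 'a list list \<Rightarrow> 'a list \<Rightarrow> 'a list \<Rightarrow> bool"
where
  "mergeable E T b ps X Y \<longleftrightarrow> hd X \<noteq> hd Y \<and> adjacent T (set X) (set Y) \<and>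
    length (filter (\<lambda>Z. \<exists>z\<in>set Z. cuts E T (set (X @ Y)) z) ps) < b"

text \<open>The nested \<open>foldr\<close> mirrors the loops \<open>fold_body\<close> of the
  program. For the intended \<open>b\<close>, the default pair of the first two parts is returned
  only when at most \<open>9 * k\<close> parts are left.\<close>

definition select ::
  "'a set set \<Rightarrow> 'a rel \<Rightarrow> nat \<Rightarrow> 'a list list \<Rightarrow> 'a list \<times> 'a list"
where
  "select E T b ps = foldr (\<lambda>X acc. foldr (\<lambda>Y acc. if mergeable E T b ps X Y then (X, Y) else acc) ps acc)
    ps (hd ps, hd (tl ps))"

primrec greedy ::
  "'a set set \<Rightarrow> 'a rel \<Rightarrow> nat \<Rightarrow> nat \<Rightarrow> 'a list list \<Rightarrow> 'a contraction list"
where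
  "greedy E T b 0 ps = []"
| "greedy E T b (Suc m) ps = (let (X, Y) = select E T b ps in
    Contract_Rows (hd X) (hd Y) # Contract_Cols (hd X) (hd Y) # greedy E T b m (merge_parts X Y ps))"

definition valid_parts :: "'a set \<Rightarrow> 'a list list \<Rightarrow> bool" where
  "valid_parts V ps \<longleftrightarrow> distinct (concat ps) \<and> set (concat ps) = V \<and> [] \<notin> set ps"

text \<open>Unlike in \<open>mixed\<close>, pairs with \<open>x = y\<close> are included: they are
  the zeros on the diagonal of the adjacency matrix of a simple graph, so a part with an edge inside
  has a red diagonal entry.\<close>

definition block :: "'a set set \<Rightarrow> 'a set \<Rightarrow> 'a set \<Rightarrow> symbol" where
  "block E X Y = (if \<forall>x\<in>X. \<forall>y\<in>Y. {x, y} \<in> E then One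
    else if \<forall>x\<in>X. \<forall>y\<in>Y. {x, y} \<notin> E then Zero else Red)"

text \<open>Entries are specified at the names of current parts only, since \<open>entry\<close>
  keeps stale values for deleted rows and columns.\<close>

definition represents :: "'a set set \<Rightarrow> 'a matrix \<Rightarrow> 'a list list \<Rightarrow> bool" where
  "represents E M ps \<longleftrightarrow> rows M = hd ` set ps \<and> cols M = hd ` set ps \<and>
    (\<forall>X\<in>set ps. \<forall>Y\<in>set ps. entry M (hd X) (hd Y) = block E (set X) (set Y))"

lemma valid_partsD:
  assumes "valid_parts V ps"
  shows "distinct ps" "\<And>X. X \<in> set ps \<Longrightarrow> X \<noteq> []" "\<And>X. X \<in> set ps \<Longrightarrow> distinct X"
    "\<And>X. X \<in> set ps \<Longrightarrow> hd X \<in> set X" "\<And>X. X \<in> set ps \<Longrightarrow> set X \<subseteq> V"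
    "\<And>X Y x. X \<in> set ps \<Longrightarrow> Y \<in> set ps \<Longrightarrow> x \<in> set X \<Longrightarrow> x \<in> set Y \<Longrightarrow> X = Y"
    "\<And>X Y. X \<in> set ps \<Longrightarrow> Y \<in> set ps \<Longrightarrow> hd X = hd Y \<Longrightarrow> X = Y"
proof -
  have d: "distinct (concat ps)" "set (concat ps) = V" "[] \<notin> set ps"
    using assms by (auto simp: valid_parts_def)
  show ne: "X \<noteq> []" if "X \<in> set ps" for X using d(3) that by auto
  show "distinct X" "set X \<subseteq> V" if "X \<in> set ps" for X
    using d(1,2) that by (auto simp: distinct_concat_iff)
  show hd: "hd X \<in> set X" if "X \<in> set ps" for X using ne that by simp
  show eq: "X = Y" if "X \<in> set ps" "Y \<in> set ps" "x \<in> set X" "x \<in> set Y" for X Y x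
    using d(1) that by (auto simp: distinct_concat_iff)
  show "X = Y" if "X \<in> set ps" "Y \<in> set ps" "hd X = hd Y" for X Y
    using eq[OF that(1,2)] hd that by metis
  show "distinct ps"
    using d(1,3) by (simp add: distinct_concat_iff removeAll_id)
qed

lemma length_valid_parts_le:
  assumes "valid_parts V ps" "finite V"
  shows "length ps \<le> card V" "\<And>X. X \<in> set ps \<Longrightarrow> length X \<le> card V"
proof -
  note d = valid_partsD[OF assms(1)]
  have "length ps = card (hd ` set ps)"
    using d(1,7) by (simp add: distinct_card inj_onI card_image)
  also have "\<dots> \<le> card V"
    using d(4,5) assms(2) by (intro card_mono) auto
  finally show "length ps \<le> card V" .
  show "length X \<le> card V" if "X \<in> set ps" for X
    using d(3,5) that assms(2) by (metis card_mono distinct_card)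
qed

lemma set_merge_parts:
  assumes "valid_parts V ps" "X \<in> set ps" "Y \<in> set ps"
  shows "set (merge_parts X Y ps) = insert (X @ Y) (set ps - {X, Y})"
proof -
  have "hd Z \<noteq> hd X \<and> hd Z \<noteq> hd Y \<longleftrightarrow> Z \<notin> {X, Y}" if "Z \<in> set ps" for Z
    using valid_partsD(7)[OF assms(1)] assms(2,3) that by blast
  then show ?thesis by (auto simp: merge_parts_def)
qed

lemma valid_merge_parts:
  assumes v: "valid_parts V ps" and XY: "X \<in> set ps" "Y \<in> set ps" "X \<noteq> Y"
  shows "valid_parts V (merge_parts X Y ps)"
proof -
  note d = valid_partsD[OF v]
  let ?qs = "filter (\<lambda>Z. hd Z \<noteq> hd X \<and> hd Z \<noteq> hd Y) ps"
  have disj: "set Z \<inter> set Z' = {}" if "Z \<in> set ps" "Z' \<in> set ps" "Z \<noteq> Z'" for Z Z'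
    using d(6) that by blast
  have "set X \<inter> set Z = {}" "set Y \<inter> set Z = {}" if "Z \<in> set ?qs" for Z
    using that disj XY by auto
  then have "set (X @ Y) \<inter> set (concat ?qs) = {}" by auto
  moreover have "distinct (X @ Y)" using d(3) disj XY by simp
  moreover have "distinct (concat ?qs)"
    using d(1,3) disj by (intro distinct_concat) auto
  ultimately have "distinct ((X @ Y) @ concat ?qs)"
    by (simp only: distinct_append)
  then have "distinct (concat (merge_parts X Y ps))"
    by (simp only: merge_parts_def concat.simps)
  moreover have "set (concat (merge_parts X Y ps)) = V"
  proof -
    have "set (concat ps) = V" using v by (simp add: valid_parts_def)
    then show ?thesis
      using XY by (auto simp: set_merge_parts[OF v XY(1,2)])
  qed
  moreover have "[] \<notin> set (merge_parts X Y ps)"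
    using d(2) XY by (auto simp: set_merge_parts[OF v XY(1,2)])
  ultimately show ?thesis by (simp add: valid_parts_def)
qed

lemma length_merge_parts:
  assumes v: "valid_parts V ps" and XY: "X \<in> set ps" "Y \<in> set ps" "X \<noteq> Y"
  shows "Suc (length (merge_parts X Y ps)) = length ps"
proof -
  have "card (set ps - {X, Y}) = card (set ps) - 2"
    using XY by (subst card_Diff_subset) auto
  moreover have "card {X, Y} \<le> card (set ps)"
    using XY by (intro card_mono) auto
  moreover have "X @ Y \<notin> set ps - {X, Y}"
    using valid_partsD(6)[OF v, of X "X @ Y" "hd X"] valid_partsD(2,4)[OF v XY(1)] XY by auto
  moreover have "length (merge_parts X Y ps) = card (set (merge_parts X Y ps))" "length ps = card (set ps)"
    using valid_partsD(1)[OF v] valid_partsD(1)[OF valid_merge_parts[OF assms]] by (simp_all add: distinct_card)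
  ultimately show ?thesis
    using XY(3) by (simp add: set_merge_parts[OF v XY(1,2)])
qed

lemma set_image_merge_parts:
  assumes v: "valid_parts V ps" and XY: "X \<in> set ps" "Y \<in> set ps"
  shows "set ` set (merge_parts X Y ps) = insert (set X \<union> set Y) (set ` set ps - {set X, set Y})"
proof -
  have "set Z \<noteq> set X" if "Z \<in> set ps" "Z \<noteq> X" "X \<in> set ps" for Z X
    using valid_partsD(4,6)[OF v] that by metis
  then show ?thesis
    using XY by (auto simp: set_merge_parts[OF v XY])
qed

lemma length_filter_cut:
  assumes v: "valid_parts V ps"
  shows "length (filter (\<lambda>Z. \<exists>z\<in>set Z. cuts E T U z) ps) = cut_degree E T (set ` set ps) U"
proof -
  note d = valid_partsD[OF v]
  have "inj_on set (set ps)" using d(4,6) by (metis inj_onI)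
  then have inj: "inj_on set {Z \<in> set ps. \<exists>z\<in>set Z. cuts E T U z}" by (rule inj_on_subset) auto
  have "length (filter (\<lambda>Z. \<exists>z\<in>set Z. cuts E T U z) ps) = card {Z \<in> set ps. \<exists>z\<in>set Z. cuts E T U z}"
    using d(1) by (subst distinct_card[symmetric]) simp_all
  also have "\<dots> = card (set ` {Z \<in> set ps. \<exists>z\<in>set Z. cuts E T U z})"
    using inj by (simp add: card_image)
  also have "set ` {Z \<in> set ps. \<exists>z\<in>set Z. cuts E T U z} = {Z \<in> set ` set ps. \<exists>z\<in>Z. cuts E T U z}" by auto
  finally show ?thesis by (simp add: cut_degree_def)
qed

lemma select_cases:
  assumes "select E T b ps = (X, Y)"
  shows "X \<in> set ps \<and> Y \<in> set ps \<and> mergeable E T b ps X Y \<or>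
    (\<forall>X\<in>set ps. \<forall>Y\<in>set ps. \<not> mergeable E T b ps X Y) \<and> X = hd ps \<and> Y = hd (tl ps)"
proof -
  let ?g = "\<lambda>X qs acc. foldr (\<lambda>Y acc. if mergeable E T b ps X Y then (X, Y) else acc) qs acc"
  have inner: "(\<forall>Y\<in>set qs. \<not> mergeable E T b ps X Y) \<and> ?g X qs acc = acc \<or>
      (\<exists>Y\<in>set qs. mergeable E T b ps X Y \<and> ?g X qs acc = (X, Y))" for X qs acc
    by (induction qs) auto
  have "(\<forall>X\<in>set qs. \<forall>Y\<in>set ps. \<not> mergeable E T b ps X Y) \<and>
        foldr (\<lambda>X. ?g X ps) qs acc = acc \<or>
      (\<exists>X\<in>set qs. \<exists>Y\<in>set ps. mergeable E T b ps X Y \<and> foldr (\<lambda>X. ?g X ps) qs acc = (X, Y))" for qs acc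
  proof (induction qs)
    case (Cons X qs)
    then show ?case
      using inner[of ps X "foldr (\<lambda>X. ?g X ps) qs acc"] by auto
  qed simp
  from this[of ps "(hd ps, hd (tl ps))"] show ?thesis
    using assms unfolding select_def by auto
qed

lemma select_distinct:
  assumes v: "valid_parts V ps" and ps: "2 \<le> length ps" and sel: "select E T b ps = (X, Y)"
  shows "X \<in> set ps" "Y \<in> set ps" "X \<noteq> Y"
proof -
  obtain A B qs where ps_eq: "ps = A # B # qs" using ps by (cases ps; cases "tl ps") auto
  show "X \<in> set ps" "Y \<in> set ps" "X \<noteq> Y"
    using select_cases[OF sel] valid_partsD(1)[OF v] by (auto simp: ps_eq mergeable_def)
qed

text \<open>For nonempty sets the two constant cases exclude each other, and a red block stays red
  in any larger one, just as \<open>Red\<close> absorbs under \<open>merge\<close>.\<close>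

lemma merge_block:
  assumes "X \<noteq> {}" "Y \<noteq> {}" "Z \<noteq> {}"
  shows "merge (block E X Z) (block E Y Z) = block E (X \<union> Y) Z"
    "merge (block E Z X) (block E Z Y) = block E Z (X \<union> Y)"
proof -
  have "\<not> ((\<forall>x\<in>A. \<forall>y\<in>B. {x, y} \<in> E) \<and> (\<forall>x\<in>A. \<forall>y\<in>B. {x, y} \<notin> E))"
    if "A \<noteq> {}" "B \<noteq> {}" for A B
    using that by blast
  from this[of X Z] this[of Y Z] this[of Z X] this[of Z Y] assms
  show "merge (block E X Z) (block E Y Z) = block E (X \<union> Y) Z"
    "merge (block E Z X) (block E Z Y) = block E Z (X \<union> Y)"
    unfolding merge_def block_def ball_Un ball_conj_distrib by simp_all
qed

lemma block_Red: "block E X Y = Red \<longleftrightarrow> (\<exists>x\<in>X. \<exists>y\<in>Y. {x, y} \<in> E) \<and> (\<exists>x\<in>X. \<exists>y\<in>Y. {x, y} \<notin> E)"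
proof -
  have "(\<exists>x\<in>X. \<exists>y\<in>Y. {x, y} \<in> E) \<longleftrightarrow> \<not> (\<forall>x\<in>X. \<forall>y\<in>Y. {x, y} \<notin> E)"
    "(\<exists>x\<in>X. \<exists>y\<in>Y. {x, y} \<notin> E) \<longleftrightarrow> \<not> (\<forall>x\<in>X. \<forall>y\<in>Y. {x, y} \<in> E)"
    by blast+
  then show ?thesis by (simp only: block_def split: if_split) simp
qed

lemma block_commute: "block E X Y = block E Y X"
proof -
  have "(\<forall>x\<in>X. \<forall>y\<in>Y. Q {x, y}) \<longleftrightarrow> (\<forall>y\<in>Y. \<forall>x\<in>X. Q {y, x})" for Q
    by (metis insert_commute)
  from this[of "\<lambda>e. e \<in> E"] this[of "\<lambda>e. e \<notin> E"] show ?thesis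
    by (simp only: block_def)
qed

text \<open>The diagonal entry of the new part is made of four blocks, joined first by rows and then
  by columns.\<close>

lemma represents_contract:
  assumes v: "valid_parts V ps" and M: "represents E M ps"
    and XY: "X \<in> set ps" "Y \<in> set ps" "X \<noteq> Y"
  shows "represents E (contract (Contract_Cols (hd X) (hd Y)) (contract (Contract_Rows (hd X) (hd Y)) M))
    (merge_parts X Y ps)"
proof -
  note d = valid_partsD[OF v]
  have hd_neq: "hd Z \<noteq> hd X" "hd Z \<noteq> hd Y" if "Z \<in> set ps" "Z \<noteq> X" "Z \<noteq> Y" for Z
    using d(7) XY that by blast+
  have XY_neq: "hd X \<noteq> hd Y" using d(7) XY by blast
  have hd: "hd (X @ Y) = hd X" using d(2) XY by simp
  have rows: "hd ` set (merge_parts X Y ps) = hd ` set ps - {hd Y}"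
    unfolding set_merge_parts[OF v XY(1,2)] using hd hd_neq XY XY_neq by (auto simp: image_iff)
  have M': "rows M = hd ` set ps" "cols M = hd ` set ps"
    "\<And>A B. A \<in> set ps \<Longrightarrow> B \<in> set ps \<Longrightarrow> entry M (hd A) (hd B) = block E (set A) (set B)"
    using M by (auto simp: represents_def)
  have ne: "\<And>Z. Z \<in> set ps \<Longrightarrow> set Z \<noteq> {}" using d(2) by simp
  note mb = merge_block[OF ne ne ne] merge_block[of "set X" "set Y" "set X \<union> set Y"]
  show ?thesis
    unfolding represents_def
  proof (intro conjI ballI)
    fix A B assume AB: "A \<in> set (merge_parts X Y ps)" "B \<in> set (merge_parts X Y ps)"
    then have "A = X @ Y \<or> A \<in> set ps \<and> A \<noteq> X \<and> A \<noteq> Y" "B = X @ Y \<or> B \<in> set ps \<and> B \<noteq> X \<and> B \<noteq> Y"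
      by (auto simp: set_merge_parts[OF v XY(1,2)])
    then show "entry (contract (Contract_Cols (hd X) (hd Y)) (contract (Contract_Rows (hd X) (hd Y)) M)) (hd A) (hd B) =
        block E (set A) (set B)"
      using XY XY_neq hd_neq M'(3) ne by (elim disjE) (auto simp: hd merge_block)
  qed (simp_all add: rows M')
qed

lemma represents_singletons:
  "set vs = V \<Longrightarrow> represents E (adjacency_matrix V E) (map (\<lambda>v. [v]) vs)"
  by (simp add: represents_def adjacency_matrix_def block_def image_image)

lemma represents_red_number_le:
  assumes v: "valid_parts V ps" and M: "represents E M ps" and ne: "ps \<noteq> []"
    and red: "\<And>X. X \<in> set ps \<Longrightarrow> card {Y \<in> set ps. block E (set X) (set Y) = Red} \<le> d"
  shows "red_number M \<le> d"
proof -
  have M': "rows M = hd ` set ps" "cols M = hd ` set ps"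
    "\<And>A B. A \<in> set ps \<Longrightarrow> B \<in> set ps \<Longrightarrow> entry M (hd A) (hd B) = block E (set A) (set B)"
    using M by (auto simp: represents_def)
  have r: "card {y \<in> cols M. entry M (hd X) y = Red} \<le> d" if X: "X \<in> set ps" for X
  proof -
    have "{y \<in> cols M. entry M (hd X) y = Red} = hd ` {Y \<in> set ps. block E (set X) (set Y) = Red}"
      using M' X by auto
    then show ?thesis
      using card_image_le[of "{Y \<in> set ps. block E (set X) (set Y) = Red}" hd] red[OF X] by simp
  qed
  have c: "card {x \<in> rows M. entry M x (hd X) = Red} \<le> d" if X: "X \<in> set ps" for X
  proof -
    have "{x \<in> rows M. entry M x (hd X) = Red} = hd ` {Y \<in> set ps. block E (set X) (set Y) = Red}"
      using M'(1) M'(3)[OF _ X] block_commute[of E _ "set X"] by auto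
    then show ?thesis
      using card_image_le[of "{Y \<in> set ps. block E (set X) (set Y) = Red}" hd] red[OF X] by simp
  qed
  show ?thesis
    unfolding red_number_def using r c ne by (subst Max_le_iff) (auto simp: M')
qed

lemma symmetric_contraction_sequence_Nil:
  "card (rows M) = 1 \<Longrightarrow> card (cols M) = 1 \<Longrightarrow> red_number M \<le> d \<Longrightarrow>
    symmetric_contraction_sequence d M []"
  by (simp add: symmetric_contraction_sequence_def contraction_sequence_def)

text \<open>The red number is tested at even positions, so the nonsquare matrix between the two
  contractions is skipped.\<close>

lemma symmetric_contraction_sequence_Cons:
  assumes pq: "p \<noteq> q" "p \<in> rows M" "q \<in> rows M" "p \<in> cols M" "q \<in> cols M"
    and red: "red_number M \<le> d"
    and cs: "symmetric_contraction_sequence d (contract (Contract_Cols p q) (contract (Contract_Rows p q) M)) cs"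
  shows "symmetric_contraction_sequence d M (Contract_Rows p q # Contract_Cols p q # cs)"
proof -
  let ?cs = "Contract_Rows p q # Contract_Cols p q # cs"
  let ?M = "contract (Contract_Cols p q) (contract (Contract_Rows p q) M)"
  have cs': "\<forall>i<length cs. contractible (cs ! i) (fold contract (take i cs) ?M)"
    "card (rows (fold contract cs ?M)) = 1" "card (cols (fold contract cs ?M)) = 1" "symmetric_sequence cs"
    "\<forall>i\<le>length cs. even i \<longrightarrow> red_number (fold contract (take i cs) ?M) \<le> d"
    using cs by (auto simp: symmetric_contraction_sequence_def contraction_sequence_def)
  have split: "i = 0 \<or> i = Suc 0 \<or> (\<exists>j. i = Suc (Suc j))" for i
    by (metis not0_implies_Suc)
  have "contractible (Contract_Cols p q) (contract (Contract_Rows p q) M)"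
    using pq by simp
  then have "contractible (?cs ! i) (fold contract (take i ?cs) M)" if "i < length ?cs" for i
    using split[of i] that cs'(1) pq by (auto simp del: contract.simps)
  moreover have "red_number (fold contract (take i ?cs) M) \<le> d" if "i \<le> length ?cs" "even i" for i
    using split[of i] that cs'(5) red by (auto simp del: contract.simps)
  ultimately show ?thesis
    using cs'(2-4) unfolding symmetric_contraction_sequence_def contraction_sequence_def
    by (simp del: contract.simps)
qed

section \<open>Invariant and correctness of the greedy sequence\<close>

context mixed_thin
begin

text \<open>Once at most \<open>9 * k\<close> parts remain, \<open>select\<close> may join parts
  that are not consecutive, so convexity and degrees are lost; from then on the number of parts
  bounds the red number.\<close>

definition invariant :: "'a list list \<Rightarrow> bool" where
  "invariant ps \<longleftrightarrow> valid_parts V ps \<and> (length ps \<le> 9 * k \<or>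
    parts (set ` set ps) \<and> (\<forall>X\<in>set ps. cut_degree E T (set ` set ps) (set X) \<le> 9 * k))"

lemma invariant_red_number_le:
  assumes inv: "invariant ps" and M: "represents E M ps" and ne: "ps \<noteq> []"
  shows "red_number M \<le> 9 * k"
proof -
  have v: "valid_parts V ps" using inv by (simp add: invariant_def)
  show ?thesis
  proof (rule represents_red_number_le[OF v M ne])
    fix X assume X: "X \<in> set ps"
    let ?R = "{Y \<in> set ps. block E (set X) (set Y) = Red}"
    show "card ?R \<le> 9 * k"
    proof (cases "length ps \<le> 9 * k")
      case True
      have "card ?R \<le> card (set ps)" by (intro card_mono) auto
      then show ?thesis using True card_length[of ps] by linarith
    next
      case False
      then have p: "parts (set ` set ps)" "cut_degree E T (set ` set ps) (set X) \<le> 9 * k"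
        using inv X by (auto simp: invariant_def)
      have "?R \<subseteq> set (filter (\<lambda>Z. \<exists>z\<in>set Z. cuts E T (set X) z) ps)"
      proof
        fix Y assume "Y \<in> ?R"
        then show "Y \<in> set (filter (\<lambda>Z. \<exists>z\<in>set Z. cuts E T (set X) z) ps)"
          using nonconstant_cut[OF p(1), of "set X" "set Y"] X by (simp add: block_Red)
      qed
      then have "card ?R \<le> card (set (filter (\<lambda>Z. \<exists>z\<in>set Z. cuts E T (set X) z) ps))"
        by (intro card_mono) auto
      also have "\<dots> \<le> length (filter (\<lambda>Z. \<exists>z\<in>set Z. cuts E T (set X) z) ps)"
        by (rule card_length)
      finally show ?thesis using p(2) by (simp add: length_filter_cut[OF v])
    qed
  qed
qed

text \<open>Averaging shows that some pair passes the test; \<open>select\<close> may return another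
  one, but that pair passed the same test. A count below \<open>9 * k + 2\<close> before the merge
  is at most \<open>9 * k\<close> after it.\<close>

lemma select_invariant:
  assumes k: "k \<ge> 1" and inv: "invariant ps" and ps: "length ps \<ge> 2"
    and sel: "select E T (9 * k + 2) ps = (X, Y)"
  shows "X \<in> set ps" "Y \<in> set ps" "X \<noteq> Y" "invariant (merge_parts X Y ps)"
proof -
  have v: "valid_parts V ps" using inv by (simp add: invariant_def)
  note d = valid_partsD[OF v]
  show XY: "X \<in> set ps" "Y \<in> set ps" and neq: "X \<noteq> Y"
    using select_distinct[OF v ps sel] by auto
  note len = length_merge_parts[OF v XY neq]
  have v': "valid_parts V (merge_parts X Y ps)" using valid_merge_parts[OF v XY neq] .
  show "invariant (merge_parts X Y ps)"
  proof (cases "length ps \<le> 9 * k")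
    case True
    then show ?thesis using v' len by (simp add: invariant_def)
  next
    case False
    let ?P = "set ` set ps"
    have p: "parts ?P" and deg: "\<And>X. X \<in> set ps \<Longrightarrow> cut_degree E T ?P (set X) \<le> 9 * k"
      using inv False by (auto simp: invariant_def)
    have inj: "set A \<noteq> set B" if "A \<in> set ps" "B \<in> set ps" "A \<noteq> B" for A B
      using d(4,6) that by metis
    then have "card ?P = length ps"
      using d(1) by (metis card_image distinct_card inj_onI)
    then obtain A B where AB: "A \<in> set ps" "B \<in> set ps" "set A \<noteq> set B" "adjacent T (set A) (set B)"
      "cut_degree E T ?P (set A \<union> set B) \<le> 9 * k + 1"
      using mergeable_pair_exists[OF k p] False by auto
    moreover have "hd A \<noteq> hd B" using d(7) AB by blast
    ultimately have "mergeable E T (9 * k + 2) ps A B"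
      by (simp add: mergeable_def length_filter_cut[OF v])
    then have "mergeable E T (9 * k + 2) ps X Y"
      using select_cases[OF sel] AB(1,2) by blast
    then have adj: "adjacent T (set X) (set Y)" and le: "cut_degree E T ?P (set X \<union> set Y) \<le> 9 * k + 1"
      by (auto simp: mergeable_def length_filter_cut[OF v])
    have P': "set ` set (merge_parts X Y ps) = insert (set X \<union> set Y) (?P - {set X, set Y})"
      by (rule set_image_merge_parts[OF v XY])
    have "parts (set ` set (merge_parts X Y ps))"
      unfolding P' using p XY inj[OF XY neq] adj by (intro parts_merge) auto
    moreover have "cut_degree E T (set ` set (merge_parts X Y ps)) (set Z) \<le> 9 * k"
      if "Z \<in> set (merge_parts X Y ps)" for Z
    proof (cases "Z = X @ Y")
      case True
      have "Suc (cut_degree E T (insert (set X \<union> set Y) (?P - {set X, set Y})) (set X \<union> set Y)) \<le>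
          cut_degree E T ?P (set X \<union> set Y)"
        using XY inj[OF XY neq] d(2) by (intro cut_degree_merged) auto
      then show ?thesis using le True unfolding P' by simp
    next
      case False
      then have "Z \<in> set ps" using that by (simp add: set_merge_parts[OF v XY])
      then show ?thesis
        using cut_degree_merge_le[of ?P "set X" "set Y" E T "set Z"] XY deg unfolding P'
        by (meson List.finite_set finite_imageI image_eqI le_trans)
    qed
    ultimately show ?thesis using v' by (simp add: invariant_def)
  qed
qed

lemma greedy_sequence:
  assumes k: "k \<ge> 1" and "invariant ps" "represents E M ps" "length ps = Suc m"
  shows "symmetric_contraction_sequence (9 * k) M (greedy E T (9 * k + 2) m ps)"
  using assms(2-)
proof (induction m arbitrary: M ps)
  case 0
  then have "red_number M \<le> 9 * k" by (intro invariant_red_number_le) auto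
  moreover obtain A where "ps = [A]" using 0 by (auto simp: length_Suc_conv)
  ultimately show ?case
    using 0 by (auto simp: represents_def intro!: symmetric_contraction_sequence_Nil)
next
  case (Suc m)
  obtain X Y where sel: "select E T (9 * k + 2) ps = (X, Y)" by force
  have v: "valid_parts V ps" using Suc.prems by (simp add: invariant_def)
  have "2 \<le> length ps" using Suc.prems by simp
  note s = select_invariant[OF k Suc.prems(1) this sel]
  have "hd X \<noteq> hd Y" using valid_partsD(7)[OF v] s by blast
  moreover have "red_number M \<le> 9 * k" using Suc.prems by (intro invariant_red_number_le) auto
  moreover have "symmetric_contraction_sequence (9 * k)
      (contract (Contract_Cols (hd X) (hd Y)) (contract (Contract_Rows (hd X) (hd Y)) M))
      (greedy E T (9 * k + 2) m (merge_parts X Y ps))"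
    using Suc.IH[OF s(4) represents_contract[OF v Suc.prems(2) s(1-3)]]
      length_merge_parts[OF v s(1-3)] Suc.prems(3) by simp
  ultimately show ?case
    using s(1,2) Suc.prems(2) unfolding greedy.simps sel Let_def prod.case
    by (intro symmetric_contraction_sequence_Cons) (simp_all add: represents_def del: contract.simps)
qed

lemma invariant_singletons:
  assumes "k \<ge> 1" "distinct vs" "set vs = V"
  shows "invariant (map (\<lambda>v. [v]) vs)"
proof -
  have eq: "set ` set (map (\<lambda>v. [v]) vs) = (\<lambda>x. {x}) ` V"
    using assms(3) by (simp add: image_image)
  have "concat (map (\<lambda>v. [v]) vs) = vs" by (induction vs) auto
  then have "valid_parts V (map (\<lambda>v. [v]) vs)"
    using assms(2,3) by (auto simp: valid_parts_def)
  then show ?thesis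
    unfolding invariant_def eq using parts_singletons cut_degree_singletons[OF assms(1)] assms(3) by auto
qed

theorem greedy_singletons:
  assumes "k \<ge> 1" "distinct vs" "set vs = V" "V \<noteq> {}"
  shows "symmetric_contraction_sequence (9 * k) (adjacency_matrix V E)
    (greedy E T (9 * k + 2) (length vs - 1) (map (\<lambda>v. [v]) vs))"
proof (rule greedy_sequence[OF assms(1) invariant_singletons[OF assms(1-3)] represents_singletons[OF assms(3)]])
  have "vs \<noteq> []" using assms(3,4) by auto
  then show "length (map (\<lambda>v. [v]) vs) = Suc (length vs - 1)" by simp
qed

end

section \<open>Evaluation of programs\<close>

text \<open>Upper bounds compose by monotonicity, which avoids exact step counts.\<close>

definition evals :: "program \<Rightarrow> tree list \<Rightarrow> expr \<Rightarrow> tree \<Rightarrow> nat \<Rightarrow> bool" where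
  "evals Q xs e v b \<longleftrightarrow> (\<exists>t\<le>b. run Q xs e v t)"

definition calls :: "program \<Rightarrow> nat \<Rightarrow> tree list \<Rightarrow> tree \<Rightarrow> nat \<Rightarrow> bool" where
  "calls Q f xs v b \<longleftrightarrow> f < length Q \<and> evals Q xs (Q ! f) v b"

text \<open>Macros with one evaluation rule each, so that evaluation is syntax-directed.\<close>

definition "arg0 = Param 0"
definition "arg1 = Param 1"
definition "arg2 = Param 2"
definition "True_expr = Mk_Node Mk_Leaf Mk_Leaf"
definition "And_expr a b = If_Node a b Mk_Leaf"
definition "Not_expr a = If_Node a Mk_Leaf True_expr"
definition "Or_expr a b = If_Node a True_expr b"
definition "Iff_expr a b = If_Node a b (Not_expr b)"
definition "Pos_expr a = If_Node a True_expr Mk_Leaf"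
definition "Cond_expr c a b = If_Node c a b"
definition "Suc_expr a = Mk_Node Mk_Leaf a"
definition "Pred_expr a = Right a"
definition "Head_expr a = Left a"
definition "Tail_expr a = Right a"
definition "Cons_expr a b = Mk_Node a b"

lemma evals_mono: "evals Q xs e v s \<Longrightarrow> s \<le> t \<Longrightarrow> evals Q xs e v t"
  unfolding evals_def by (meson le_trans)

lemma evals_cast: "evals Q xs e v s \<Longrightarrow> v = w \<Longrightarrow> s \<le> t \<Longrightarrow> evals Q xs e w t"
  using evals_mono by blast

lemma calls_mono: "calls Q f xs v s \<Longrightarrow> s \<le> t \<Longrightarrow> calls Q f xs v t"
  unfolding calls_def using evals_mono by blast

lemma calls_cast: "calls Q f xs v s \<Longrightarrow> v = w \<Longrightarrow> s \<le> t \<Longrightarrow> calls Q f xs w t"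
  using calls_mono by blast

lemma callsI: "f < length Q \<Longrightarrow> Q ! f = e \<Longrightarrow> evals Q xs e v s \<Longrightarrow> v = w \<Longrightarrow> s \<le> t \<Longrightarrow> calls Q f xs w t"
  unfolding calls_def using evals_mono by blast

lemma evals_arg:
  "evals Q (x # xs) arg0 x 1" "evals Q (x # y # xs) arg1 y 1" "evals Q (x # y # z # xs) arg2 z 1"
  using run_Param[of 0 "x # xs" Q] run_Param[of 1 "x # y # xs" Q] run_Param[of 2 "x # y # z # xs" Q]
  unfolding evals_def arg0_def arg1_def arg2_def by auto

lemma evals_Mk_Leaf: "evals Q xs Mk_Leaf Leaf 1"
  unfolding evals_def using run_Leaf by blast

lemma evals_Mk_Node: "evals Q xs a v s \<Longrightarrow> evals Q xs b w t \<Longrightarrow> evals Q xs (Mk_Node a b) (Node v w) (s + t + 1)"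
  unfolding evals_def by (meson add_le_mono le_refl run_Node)

lemma evals_left: "evals Q xs a v t \<Longrightarrow> evals Q xs (Left a) (left v) (t + 1)"
  unfolding evals_def by (meson add_le_mono le_refl run_Left)

lemma evals_right: "evals Q xs a v t \<Longrightarrow> evals Q xs (Right a) (right v) (t + 1)"
  unfolding evals_def by (meson add_le_mono le_refl run_Right)

lemma evals_Left: "evals Q xs a (Node v w) t \<Longrightarrow> evals Q xs (Left a) v (t + 1)"
  using evals_left by fastforce

lemma evals_Right: "evals Q xs a (Node v w) t \<Longrightarrow> evals Q xs (Right a) w (t + 1)"
  using evals_right by fastforce

text \<open>Each branch is evaluated under its own condition, so recursion behind a test can be
  treated; adding both bounds avoids a maximum.\<close>

lemma evals_If_Node:
  assumes "evals Q xs c u s" "u \<noteq> Leaf \<Longrightarrow> evals Q xs a v t" "u = Leaf \<Longrightarrow> evals Q xs b v t'"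
  shows "evals Q xs (If_Node c a b) v (s + t + t' + 1)"
proof -
  obtain s' where s': "s' \<le> s" "run Q xs c u s'" using assms(1) by (auto simp: evals_def)
  show ?thesis
  proof (cases u)
    case Leaf
    then obtain r where r: "r \<le> t'" "run Q xs b v r" using assms(3) by (auto simp: evals_def)
    then have "run Q xs (If_Node c a b) v (s' + r + 1)"
      using s'(2) unfolding Leaf by (intro run_If_False)
    moreover have "s' + r + 1 \<le> s + t + t' + 1" using r s' by simp
    ultimately show ?thesis unfolding evals_def by blast
  next
    case (Node x y)
    then obtain r where r: "r \<le> t" "run Q xs a v r" using assms(2) by (auto simp: evals_def)
    then have "run Q xs (If_Node c a b) v (s' + r + 1)"
      using s'(2) unfolding Node by (intro run_If_True)
    moreover have "s' + r + 1 \<le> s + t + t' + 1" using r s' by simp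
    ultimately show ?thesis unfolding evals_def by blast
  qed
qed

lemma encode_bool_eq_Leaf [simp]: "encode_bool b = Leaf \<longleftrightarrow> \<not> b"
  by (cases b) auto

lemma evals_True_expr: "evals Q xs True_expr (encode_bool True) 3"
  unfolding True_expr_def using evals_Mk_Node[OF evals_Mk_Leaf evals_Mk_Leaf, of Q xs]
  by (simp add: numeral_3_eq_3)

text \<open>Both branches have to terminate here, which suits conditionals without recursion and
  keeps the evaluation free of case distinctions.\<close>

lemma evals_Cond_expr:
  assumes "evals Q xs c (encode_bool B) s" "evals Q xs a v t" "evals Q xs b w t'"
  shows "evals Q xs (Cond_expr c a b) (if B then v else w) (s + t + t' + 1)"
  unfolding Cond_expr_def using assms by (intro evals_If_Node) auto

lemma evals_And_expr:
  assumes "evals Q xs a (encode_bool A) s" "evals Q xs b (encode_bool B) t"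
  shows "evals Q xs (And_expr a b) (encode_bool (A \<and> B)) (s + t + 2)"
  using evals_Cond_expr[OF assms evals_Mk_Leaf] unfolding Cond_expr_def And_expr_def
  by (elim evals_cast) auto

lemma evals_Not_expr:
  assumes "evals Q xs a (encode_bool A) s"
  shows "evals Q xs (Not_expr a) (encode_bool (\<not> A)) (s + 5)"
  using evals_Cond_expr[OF assms evals_Mk_Leaf evals_True_expr] unfolding Cond_expr_def Not_expr_def
  by (elim evals_cast) auto

lemma evals_Or_expr:
  assumes "evals Q xs a (encode_bool A) s" "evals Q xs b (encode_bool B) t"
  shows "evals Q xs (Or_expr a b) (encode_bool (A \<or> B)) (s + t + 4)"
  using evals_Cond_expr[OF assms(1) evals_True_expr assms(2)] unfolding Cond_expr_def Or_expr_def
  by (elim evals_cast) auto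

lemma evals_Iff_expr:
  assumes "evals Q xs a (encode_bool A) s" "evals Q xs b (encode_bool B) t"
  shows "evals Q xs (Iff_expr a b) (encode_bool (A \<longleftrightarrow> B)) (s + 2 * t + 6)"
  using evals_Cond_expr[OF assms evals_Not_expr[OF assms(2)]] unfolding Cond_expr_def Iff_expr_def
  by (elim evals_cast) auto

lemma evals_Pos_expr:
  assumes "evals Q xs a (encode_nat m) s"
  shows "evals Q xs (Pos_expr a) (encode_bool (0 < m)) (s + 5)"
  unfolding Pos_expr_def
  by (rule evals_mono[OF evals_If_Node[OF assms, of _ _ 3 _ 1]])
    (use evals_True_expr[of Q xs] evals_Mk_Leaf[of Q xs] in \<open>cases m; simp\<close>)+

lemma evals_Suc_expr: "evals Q xs a (encode_nat m) s \<Longrightarrow> evals Q xs (Suc_expr a) (encode_nat (Suc m)) (s + 2)"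
  unfolding Suc_expr_def using evals_Mk_Node[OF evals_Mk_Leaf, of Q xs a "encode_nat m" s] by simp

lemma evals_Pred_expr: "evals Q xs a (encode_nat m) s \<Longrightarrow> evals Q xs (Pred_expr a) (encode_nat (m - 1)) (s + 1)"
  unfolding Pred_expr_def using evals_right[of Q xs a "encode_nat m" s] by (cases m) auto

lemma evals_Head_expr:
  "evals Q xs a (encode_list f ys) s \<Longrightarrow> ys \<noteq> [] \<Longrightarrow> evals Q xs (Head_expr a) (f (hd ys)) (s + 1)"
  unfolding Head_expr_def using evals_left[of Q xs a "encode_list f ys" s] by (cases ys) auto

lemma evals_Tail_expr:
  "evals Q xs a (encode_list f ys) s \<Longrightarrow> evals Q xs (Tail_expr a) (encode_list f (tl ys)) (s + 1)"
  unfolding Tail_expr_def using evals_right[of Q xs a "encode_list f ys" s] by (cases ys) auto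

lemma evals_Cons_expr:
  "evals Q xs b (encode_list f ys) t \<Longrightarrow> evals Q xs a (f y) s \<Longrightarrow>
    evals Q xs (Cons_expr a b) (encode_list f (y # ys)) (s + t + 1)"
  unfolding Cons_expr_def using evals_Mk_Node[of Q xs a "f y" s b] by simp

lemma evals_Call:
  assumes "evals Q xs a u s" "evals Q xs b v s'" "evals Q xs c w s''" "calls Q f [u, v, w] z t"
  shows "evals Q xs (Call f [a, b, c]) z (s + s' + s'' + t + 1)"
proof -
  obtain q q' q'' r where q: "q \<le> s" "q' \<le> s'" "q'' \<le> s''" "r \<le> t"
    "run Q xs a u q" "run Q xs b v q'" "run Q xs c w q''" "run Q [u, v, w] (Q ! f) z r" "f < length Q"
    using assms unfolding evals_def calls_def by blast
  have "runs Q xs [a, b, c] [u, v, w] (q + (q' + (q'' + 0)))"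
    using q by (intro run_runs.intros)
  then have "run Q xs (Call f [a, b, c]) z (q + (q' + (q'' + 0)) + r + 1)"
    using q by (intro run_Call)
  moreover have "q + (q' + (q'' + 0)) + r + 1 \<le> s + s' + s'' + t + 1" using q by simp
  ultimately show ?thesis unfolding evals_def by blast
qed

lemmas evals_rules = evals_arg evals_Mk_Leaf evals_Mk_Node evals_Left evals_Right evals_True_expr
  evals_Cond_expr evals_And_expr evals_Not_expr evals_Or_expr evals_Iff_expr evals_Pos_expr
  evals_Suc_expr evals_Pred_expr evals_Head_expr evals_Tail_expr evals_Cons_expr evals_Call

text \<open>The function with index \<open>f\<close> folds the one with index \<open>g\<close> over a list, with a base value and a
  context that is passed on unchanged.\<close>

definition fold_body :: "nat \<Rightarrow> nat \<Rightarrow> expr" where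
  "fold_body f g = If_Node arg0
    (Call g [Left arg0, Call f [Right arg0, arg1, arg2], arg2]) arg1"

text \<open>The tail is processed before the head, hence \<open>foldr\<close>. The 15 covers the
  parameter accesses, the test and the two calls of a round; \<open>d\<close> leaves room for a
  rounder bound.\<close>

lemma calls_fold:
  assumes f: "f < length Q" "Q ! f = fold_body f g"
    and step: "\<And>x a. x \<in> set xs \<Longrightarrow> calls Q g [enc x, enc' a, ctx] (enc' (h x a)) c"
    and len: "length xs \<le> N" and c: "c + 15 \<le> d"
  shows "calls Q f [encode_list enc xs, enc' b, ctx] (enc' (foldr h xs b)) ((N + 1) * d)"
proof -
  have "calls Q f [encode_list enc xs, enc' b, ctx] (enc' (foldr h xs b)) ((length xs + 1) * (c + 15))"
    using step
  proof (induction xs)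
    case Nil
    show ?case
      \<comment> \<open>The branch for a nonempty list contradicts its condition, so the bound 0 may
        be claimed for it; similarly for \<open>t' = 0\<close> below.\<close>
      by (rule callsI[OF f], unfold fold_body_def, rule evals_If_Node[where t = 0], rule evals_arg, simp, rule evals_arg) auto
  next
    case (Cons x xs)
    then have IH: "calls Q f [encode_list enc xs, enc' b, ctx] (enc' (foldr h xs b)) ((length xs + 1) * (c + 15))"
      by simp
    have step: "calls Q g [enc x, enc' (foldr h xs b), ctx] (enc' (h x (foldr h xs b))) c"
      using Cons.prems by simp
    show ?case
      by (rule callsI[OF f], unfold fold_body_def encode_list.simps, rule evals_If_Node[where t' = 0], rule evals_arg,
        (rule evals_rules IH step)+) auto
  qed
  then show ?thesis
    by (rule calls_mono) (use len c in \<open>intro mult_le_mono; simp\<close>)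
qed

lemma foldr_disj: "foldr (\<lambda>x a. P x \<or> a) xs b \<longleftrightarrow> (\<exists>x\<in>set xs. P x) \<or> b"
  by (induction xs) auto

lemma calls_exists:
  assumes "f < length Q" "Q ! f = fold_body f g"
    and "\<And>x a. x \<in> set xs \<Longrightarrow> calls Q g [enc x, encode_bool a, ctx] (encode_bool (P x \<or> a)) c"
    and "length xs \<le> N" and "c + 15 \<le> d"
  shows "calls Q f [encode_list enc xs, Leaf, ctx] (encode_bool (\<exists>x\<in>set xs. P x)) ((N + 1) * d)"
  using calls_fold[OF assms(1,2), of xs enc encode_bool ctx "\<lambda>x a. P x \<or> a" c N d False] assms(3-5)
  by (simp add: foldr_disj)

section \<open>The program\<close>

text \<open>Functions other than the main one take three arguments, so that the single rule
  \<open>evals_Call\<close> suffices; shorter argument lists are padded with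
  \<open>Mk_Leaf\<close>.\<close>

definition "Entry_expr M x y = Call 2 [Call 2 [M, x, Mk_Leaf], y, Mk_Leaf]"
definition "Eq_expr x y = Call 3 [x, y, Mk_Leaf]"
definition "matrix_of d = Left d"
definition "orders_of d = Left (Right d)"
definition "vertices_of d = Left (Right (Right d))"
definition "budget_of d = Right (Right (Right d))"

text \<open>A loop occupies two consecutive indices, \<open>fold_body f (f + 1)\<close> and its
  step. There are no closures, so everything that a step has to know is packed into
  \<open>arg2\<close>.\<close>

definition prog :: program where
  "prog = [
    \<comment> \<open>0, 1: main\<close>
    Call 1 [Mk_Node (Left arg0) (Mk_Node (Right (Right arg0)) (Mk_Node
      (Call 35 [Left arg0, Mk_Leaf, Mk_Leaf])
      (Call 39 [Right (Right arg0), Mk_Node Mk_Leaf (Mk_Node Mk_Leaf Mk_Leaf), Mk_Leaf]))), Mk_Leaf, Mk_Leaf],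
    Call 34 [Call 37 [vertices_of arg0, Mk_Leaf, Mk_Leaf], arg0, Mk_Leaf],
    \<comment> \<open>2: element of a list; 3: equality of numbers\<close>
    If_Node arg1 (Call 2 [Right arg0, Right arg1, arg2]) (Left arg0),
    If_Node arg0 (If_Node arg1 (Call 3 [Right arg0, Right arg1, arg2]) Mk_Leaf) (Not_expr (Pos_expr arg1)),
    \<comment> \<open>4: \<open>T\<close>; 6: an element between two; 8: \<open>covers\<close>\<close>
    fold_body 4 5,
    Or_expr (Entry_expr (Head_expr arg0) (Left arg2) (Right arg2)) arg1,
    fold_body 6 7,
    Or_expr (And_expr (Not_expr (Eq_expr arg0 (Left (Left arg2))))
      (And_expr (Not_expr (Eq_expr arg0 (Right (Left arg2))))
      (And_expr (Call 4 [Right arg2, Mk_Leaf, Mk_Node (Left (Left arg2)) arg0])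
        (Call 4 [Right arg2, Mk_Leaf, Mk_Node arg0 (Right (Left arg2))])))) arg1,
    And_expr (Not_expr (Eq_expr arg0 arg1))
      (And_expr (Call 4 [orders_of arg2, Mk_Leaf, Mk_Node arg0 arg1])
      (Not_expr (Call 6 [vertices_of arg2, Mk_Leaf, Mk_Node (Mk_Node arg0 arg1) (orders_of arg2)]))),
    \<comment> \<open>9, 11: an entry with a given value in a row, in several rows, within a window\<close>
    fold_body 9 10,
    Or_expr (And_expr (Or_expr (Eq_expr arg0 (Right (Right (Left arg2))))
        (Call 8 [Right (Right (Left arg2)), arg0, Right arg2]))
      (And_expr (Not_expr (Eq_expr (Left (Right (Left arg2))) arg0))
        (Iff_expr (Left (Left arg2)) (Entry_expr (matrix_of (Right arg2)) (Left (Right (Left arg2))) arg0)))) arg1,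
    fold_body 11 12,
    Or_expr (Call 9 [vertices_of (Right arg2), Mk_Leaf,
      Mk_Node (Mk_Node (Left (Left arg2)) (Mk_Node arg0 (Right (Left arg2)))) (Right arg2)]) arg1,
    \<comment> \<open>13: membership; 15: \<open>cuts\<close>; 16: a cut vertex in a part; 18: the budget that the cut parts leave\<close>
    fold_body 13 14,
    Or_expr (Eq_expr arg0 arg2) arg1,
    Or_expr (Call 13 [arg0, Mk_Leaf, arg1]) (And_expr
      (Call 11 [arg0, Mk_Leaf, Mk_Node (Mk_Node True_expr arg1) arg2])
      (Call 11 [arg0, Mk_Leaf, Mk_Node (Mk_Node Mk_Leaf arg1) arg2])),
    fold_body 16 17,
    Or_expr (Call 15 [Left arg2, arg0, Right arg2]) arg1,
    fold_body 18 19,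
    Cond_expr (Call 16 [arg0, Mk_Leaf, arg2]) (Pred_expr arg1) arg1,
    \<comment> \<open>20, 22: adjacency of a vertex and a part, of two parts\<close>
    fold_body 20 21,
    Or_expr (Call 8 [Left arg2, arg0, Right arg2]) arg1,
    fold_body 22 23,
    Or_expr (Call 20 [Left arg2, Mk_Leaf, Mk_Node arg0 (Right arg2)]) arg1,
    \<comment> \<open>24: append; 26: \<open>mergeable\<close>; 27, 29: \<open>select\<close>\<close>
    fold_body 24 25,
    Cons_expr arg0 arg1,
    And_expr (Not_expr (Eq_expr (Head_expr arg0) (Head_expr arg1)))
      (And_expr (Call 22 [arg0, Mk_Leaf, Mk_Node arg1 (Right arg2)])
        (Pos_expr (Call 18 [Left arg2, budget_of (Right arg2),
          Mk_Node (Call 24 [arg0, arg1, Mk_Leaf]) (Right arg2)]))),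
    fold_body 27 28,
    Cond_expr (Call 26 [Left arg2, arg0, Right arg2]) (Mk_Node (Left arg2) arg0) arg1,
    fold_body 29 30,
    Call 27 [Left arg2, arg1, Mk_Node arg0 arg2],
    \<comment> \<open>31: removal of two parts; 33, 34: \<open>greedy\<close>\<close>
    fold_body 31 32,
    Cond_expr (Eq_expr (Head_expr arg0) (Left arg2)) arg1
      (Cond_expr (Eq_expr (Head_expr arg0) (Right arg2)) arg1 (Cons_expr arg0 arg1)),
    Mk_Node (Mk_Node Mk_Leaf (Mk_Node (Head_expr (Left arg0)) (Head_expr (Right arg0))))
      (Mk_Node (Mk_Node True_expr (Mk_Node (Head_expr (Left arg0)) (Head_expr (Right arg0))))
        (Call 34 [Cons_expr (Call 24 [Left arg0, Right arg0, Mk_Leaf])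
          (Call 31 [arg1, Mk_Leaf, Mk_Node (Head_expr (Left arg0)) (Head_expr (Right arg0))]), arg2, Mk_Leaf])),
    If_Node (Right arg0) (Call 33 [Call 29 [arg0, Mk_Node (Head_expr arg0) (Head_expr (Tail_expr arg0)),
      Mk_Node arg0 arg1], arg0, arg1]) Mk_Leaf,
    \<comment> \<open>35: vertices; 37: singletons; 39: budget\<close>
    fold_body 35 36,
    Mk_Node (If_Node arg1 (Mk_Node Mk_Leaf (Left arg1)) Mk_Leaf) arg1,
    fold_body 37 38,
    Mk_Node (Mk_Node arg0 Mk_Leaf) arg1,
    fold_body 39 40,
    Suc_expr (Suc_expr (Suc_expr (Suc_expr (Suc_expr (Suc_expr (Suc_expr (Suc_expr (Suc_expr arg1))))))))]"

lemma length_prog: "length prog = 41"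
  by (simp add: prog_def)

text \<open>Bounds on the running times, for lists of length and numbers of size at most \<open>N\<close>.  The factor \<open>2 * N + 1\<close>
  accounts for the candidates \<open>X @ Y\<close>, which include \<open>X @ X\<close>.\<close>

definition "time_entry N = 40 * (N + 1) + (20 :: nat)"
definition "time_eq N = 20 * (N + 1 :: nat)"
definition "time_order N = (N + 1) * (time_entry N + 60)"
definition "time_between N = (N + 1) * (2 * time_eq N + 2 * time_order N + 200)"
definition "time_covers N = time_eq N + time_order N + time_between N + 100"
definition "time_row_entry N = (N + 1) * (2 * time_eq N + time_covers N + 2 * time_entry N + 200)"
definition "time_block_entry N = (2 * N + 1) * (time_row_entry N + 200)"
definition "time_member N = (2 * N + 1) * (time_eq N + 100)"
definition "time_cut N = time_member N + 2 * time_block_entry N + 200"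
definition "time_cut_part N = (N + 1) * (time_cut N + 100)"
definition "time_budget_left N = (N + 1) * (time_cut_part N + 100)"
definition "time_adjacent1 N = (N + 1) * (time_covers N + 100)"
definition "time_adjacent N = (N + 1) * (time_adjacent1 N + 100)"
definition "time_append N = (N + 1) * (100 :: nat)"
definition "time_mergeable N = time_eq N + time_adjacent N + time_budget_left N + time_append N + 300"
definition "time_select1 N = (N + 1) * (time_mergeable N + 100)"
definition "time_select N = (N + 1) * (time_select1 N + 100)"
definition "time_remove N = (N + 1) * (2 * time_eq N + 100)"
definition "time_step N = time_select N + time_append N + time_remove N + 500"

section \<open>Running times of the functions of the program\<close>

lemma calls_nth:
  "u < length xs \<Longrightarrow> calls prog 2 [encode_list f xs, encode_nat u, w] (f (xs ! u)) (20 * (u + 1))"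
proof (induction u arbitrary: xs)
  case 0
  then obtain y ys where xs: "xs = y # ys" by (cases xs) auto
  show ?case
    unfolding xs encode_list.simps encode_nat.simps
    by (rule callsI, simp add: length_prog, simp add: prog_def, rule evals_If_Node[where t = 0],
      rule evals_rules, simp, (rule evals_rules)+, simp_all)
next
  case (Suc u)
  then obtain y ys where xs: "xs = y # ys" "u < length ys" by (cases xs) auto
  note IH = Suc.IH[OF xs(2)]
  show ?case
    unfolding xs(1) encode_list.simps encode_nat.simps
    by (rule callsI, simp add: length_prog, simp add: prog_def, rule evals_If_Node[where t' = 0],
      rule evals_rules, (rule evals_rules IH)+, simp_all)
qed

lemma calls_eq: "calls prog 3 [encode_nat a, encode_nat b, w] (encode_bool (a = b)) (20 * (a + 1))"
proof (induction a arbitrary: b)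
  case 0
  show ?case
    by (simp, rule callsI, simp add: length_prog, simp add: prog_def, rule evals_If_Node[where t = 0],
      rule evals_rules, simp, (rule evals_rules)+, auto)
next
  case (Suc a)
  show ?case
  proof (cases b)
    case 0
    show ?thesis
    unfolding 0 encode_nat.simps
    by (rule callsI, simp add: length_prog, simp add: prog_def, rule evals_If_Node[where t' = 0],
      rule evals_rules, rule evals_If_Node[where t = 0], rule evals_rules, simp, rule evals_rules,
      simp_all)
  next
    case (Suc c)
    show ?thesis
    unfolding Suc encode_nat.simps
    by (rule callsI, simp add: length_prog, simp add: prog_def, rule evals_If_Node[where t' = 0],
      rule evals_rules, rule evals_If_Node[where t' = 0], rule evals_rules,
      (rule evals_rules Suc.IH)+, simp_all)
  qed
qed

abbreviation encode_part :: "nat list \<Rightarrow> tree" where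
  "encode_part \<equiv> encode_list encode_nat"

text \<open>\<open>N\<close> will be the size of the input, so that all time bounds depend on one
  parameter.\<close>

locale program_input =
  fixes n k N :: nat and E :: "nat set set" and L :: "nat \<Rightarrow> nat \<Rightarrow> nat rel" and T :: "nat rel"
  assumes n: "n \<le> N" and k: "k \<le> N" and T: "T = (\<Union>i\<in>{1..k}. L i i)" and T_subset: "T \<subseteq> {..<n} \<times> {..<n}"
begin

definition orders :: tree where
  "orders = encode_list (\<lambda>i. encode_list (\<lambda>j. encode_rel n (L i j)) [i..<Suc k]) [1..<Suc k]"

text \<open>Descending, because the program counts the rows of the matrix and puts the successor of
  the head in front. Any enumeration of the vertices would do for
  \<open>greedy_singletons\<close>.\<close>

definition verts :: "nat list" where
  "verts = rev [0..<n]"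

definition data :: tree where
  "data = Node (encode_rel n {(u, v). {u, v} \<in> E})
    (Node orders (Node (encode_part verts) (encode_nat (9 * k + 2))))"

lemma evals_data:
  assumes "evals prog xs d data s"
  shows "evals prog xs (matrix_of d) (encode_rel n {(u, v). {u, v} \<in> E}) (s + 1)"
    "evals prog xs (orders_of d) orders (s + 2)"
    "evals prog xs (vertices_of d) (encode_part verts) (s + 3)"
    "evals prog xs (budget_of d) (encode_nat (9 * k + 2)) (s + 3)"
proof -
  note d = assms[unfolded data_def]
  show "evals prog xs (matrix_of d) (encode_rel n {(u, v). {u, v} \<in> E}) (s + 1)"
    unfolding matrix_of_def by (rule evals_mono, rule evals_Left, rule d) simp
  show "evals prog xs (orders_of d) orders (s + 2)"
    unfolding orders_of_def by (rule evals_mono, rule evals_Left, rule evals_Right, rule d) simp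
  show "evals prog xs (vertices_of d) (encode_part verts) (s + 3)"
    unfolding vertices_of_def by (rule evals_mono, rule evals_Left, rule evals_Right, rule evals_Right, rule d) simp
  show "evals prog xs (budget_of d) (encode_nat (9 * k + 2)) (s + 3)"
    unfolding budget_of_def by (rule evals_mono, rule evals_Right, rule evals_Right, rule evals_Right, rule d) simp
qed

lemma evals_Entry_expr:
  assumes "evals prog xs m (encode_rel n R) s" "evals prog xs a (encode_nat u) s'"
    "evals prog xs b (encode_nat v) s''" "u < n" "v < n"
  shows "evals prog xs (Entry_expr m a b) (encode_bool ((u, v) \<in> R)) (s + s' + s'' + time_entry N)"
proof -
  have 1: "calls prog 2 [encode_rel n R, encode_nat u, w]
      (encode_list (\<lambda>v. encode_bool ((u, v) \<in> R)) [0..<n]) (20 * (u + 1))" for w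
    using calls_nth[of u "[0..<n]"] assms(4) by (simp add: encode_rel_def)
  have 2: "calls prog 2 [encode_list (\<lambda>v. encode_bool ((u, v) \<in> R)) [0..<n], encode_nat v, w]
      (encode_bool ((u, v) \<in> R)) (20 * (v + 1))" for w
    using calls_nth[of v "[0..<n]" "\<lambda>v. encode_bool ((u, v) \<in> R)"] assms(5) by simp
  show ?thesis
    unfolding Entry_expr_def
    by (rule evals_mono, (rule assms(1-3) evals_Mk_Leaf 1 2 evals_Call)+)
      (use assms(4,5) n in \<open>simp add: time_entry_def\<close>)
qed

lemma evals_Eq_expr:
  assumes "evals prog xs a (encode_nat u) s" "evals prog xs b (encode_nat v) s'" "u < n"
  shows "evals prog xs (Eq_expr a b) (encode_bool (u = v)) (s + s' + time_eq N + 2)"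
  unfolding Eq_expr_def
  by (rule evals_mono, (rule assms(1-2) evals_Mk_Leaf calls_eq evals_Call)+)
    (use assms(3) n in \<open>simp add: time_eq_def\<close>)

lemmas ev = evals_data evals_Entry_expr evals_Eq_expr evals_rules

text \<open>\<open>L i i\<close> is the head of the list of orders for \<open>i\<close>, as that
  list starts with \<open>j = i\<close>; the loop tries all \<open>i\<close>.\<close>

lemma calls_order:
  assumes "u < n" "v < n"
  shows "calls prog 4 [orders, Leaf, Node (encode_nat u) (encode_nat v)] (encode_bool ((u, v) \<in> T)) (time_order N)"
proof -
  have step: "calls prog 5 [encode_list (\<lambda>j. encode_rel n (L i j)) [i..<Suc k], encode_bool a,
      Node (encode_nat u) (encode_nat v)] (encode_bool ((u, v) \<in> L i i \<or> a)) (time_entry N + 30)"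
    if "i \<in> set [1..<Suc k]" for i a
  proof -
    have i: "[i..<Suc k] \<noteq> []" "hd [i..<Suc k] = i" using that by auto
    show ?thesis
      by (rule callsI, simp add: length_prog, simp add: prog_def,
        (rule ev i(1) | (simp add: assms; fail) | (simp only: i(2)))+)
  qed
  show ?thesis
    unfolding orders_def time_order_def
    by (rule calls_cast[OF calls_exists[OF _ _ step, where N = N and d = "time_entry N + 60"]],
      simp_all add: length_prog prog_def T k atLeastLessThanSuc_atLeastAtMost del: upt_Suc)
qed

lemma set_verts: "set verts = {..<n}" and length_verts: "length verts \<le> N"
  using n by (auto simp: verts_def)

lemma calls_between:
  assumes "u < n" "v < n"
  shows "calls prog 6 [encode_part verts, Leaf, Node (Node (encode_nat u) (encode_nat v)) orders]
    (encode_bool (\<exists>z\<in>set verts. z \<noteq> u \<and> z \<noteq> v \<and> (u, z) \<in> T \<and> (z, v) \<in> T)) (time_between N)"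
proof -
  have step: "calls prog 7 [encode_nat z, encode_bool a, Node (Node (encode_nat u) (encode_nat v)) orders]
      (encode_bool ((z \<noteq> u \<and> z \<noteq> v \<and> (u, z) \<in> T \<and> (z, v) \<in> T) \<or> a)) (2 * time_eq N + 2 * time_order N + 150)"
    if "z \<in> set verts" for z a
  proof -
    have z: "z < n" using that by (simp add: set_verts)
    show ?thesis
      by (rule callsI, simp add: length_prog, simp add: prog_def,
        (rule ev calls_order | (simp add: assms z; fail))+)
  qed
  show ?thesis
    unfolding time_between_def
    by (rule calls_exists[OF _ _ step], simp_all add: length_prog prog_def length_verts)
qed

text \<open>Restricts the intermediate vertex to a list that the program can search.\<close>

lemma covers_iff:
  "covers T u v \<longleftrightarrow> u \<noteq> v \<and> (u, v) \<in> T \<and> \<not> (\<exists>z\<in>set verts. z \<noteq> u \<and> z \<noteq> v \<and> (u, z) \<in> T \<and> (z, v) \<in> T)"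
  unfolding covers_def using T_subset set_verts by blast

lemma calls_covers:
  assumes "u < n" "v < n"
  shows "calls prog 8 [encode_nat u, encode_nat v, data] (encode_bool (covers T u v)) (time_covers N)"
  by (rule callsI, simp add: length_prog, simp add: prog_def,
    (rule ev calls_order calls_between | (simp add: assms; fail))+, simp only: covers_iff,
    simp add: time_covers_def)

text \<open>The flag \<open>c\<close> says whether an edge or a non-edge is sought. The window of
  \<open>v\<close> is found by testing every vertex \<open>b\<close>.\<close>

lemma calls_row_entry:
  assumes "u < n" "v < n"
  shows "calls prog 9 [encode_part verts, Leaf, Node (Node (encode_bool c) (Node (encode_nat u) (encode_nat v))) data]
    (encode_bool (\<exists>b\<in>set verts. (b = v \<or> covers T v b) \<and> u \<noteq> b \<and> (c \<longleftrightarrow> {u, b} \<in> E))) (time_row_entry N)"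
proof -
  have step: "calls prog 10 [encode_nat b, encode_bool a,
        Node (Node (encode_bool c) (Node (encode_nat u) (encode_nat v))) data]
      (encode_bool (((b = v \<or> covers T v b) \<and> u \<noteq> b \<and> (c \<longleftrightarrow> {u, b} \<in> E)) \<or> a))
      (2 * time_eq N + time_covers N + 2 * time_entry N + 150)"
    if "b \<in> set verts" for b a
  proof -
    have b: "b < n" using that by (simp add: set_verts)
    show ?thesis
      by (rule callsI, simp add: length_prog, simp add: prog_def,
        (rule ev calls_covers | (simp add: assms b; fail))+)
  qed
  show ?thesis
    unfolding time_row_entry_def
    by (rule calls_exists[OF _ _ step], simp_all add: length_prog prog_def length_verts)
qed

lemma calls_block_entry:
  assumes U: "set U \<subseteq> {..<n}" "length U \<le> 2 * N" and v: "v < n"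
  shows "calls prog 11 [encode_part U, Leaf, Node (Node (encode_bool c) (encode_nat v)) data]
    (encode_bool (\<exists>u\<in>set U. \<exists>b\<in>set verts. (b = v \<or> covers T v b) \<and> u \<noteq> b \<and> (c \<longleftrightarrow> {u, b} \<in> E)))
    (time_block_entry N)"
proof -
  have step: "calls prog 12 [encode_nat u, encode_bool a, Node (Node (encode_bool c) (encode_nat v)) data]
      (encode_bool ((\<exists>b\<in>set verts. (b = v \<or> covers T v b) \<and> u \<noteq> b \<and> (c \<longleftrightarrow> {u, b} \<in> E)) \<or> a))
      (time_row_entry N + 150)"
    if "u \<in> set U" for u a
  proof -
    have u: "u < n" using that U by auto
    show ?thesis
      by (rule callsI, simp add: length_prog, simp add: prog_def,
        (rule ev calls_row_entry | (simp add: v u; fail))+)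
  qed
  show ?thesis
    unfolding time_block_entry_def
    by (rule calls_exists[OF _ _ step], simp_all add: length_prog prog_def U)
qed

lemma calls_member:
  assumes U: "set U \<subseteq> {..<n}" "length U \<le> 2 * N" and v: "v < n"
  shows "calls prog 13 [encode_part U, Leaf, encode_nat v] (encode_bool (v \<in> set U)) (time_member N)"
proof -
  have step: "calls prog 14 [encode_nat u, encode_bool a, encode_nat v] (encode_bool (u = v \<or> a)) (time_eq N + 50)"
    if "u \<in> set U" for u a
  proof -
    have u: "u < n" using that U by auto
    show ?thesis
      by (rule callsI, simp add: length_prog, simp add: prog_def, (rule ev | (simp add: v u; fail))+)
  qed
  show ?thesis
    unfolding time_member_def
    by (rule calls_cast[OF calls_exists[OF _ _ step, where N = "2 * N" and d = "time_eq N + 100"]],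
      simp_all add: length_prog prog_def U)
qed

lemma cuts_iff:
  assumes "v < n"
  shows "cuts E T U v \<longleftrightarrow> v \<in> U \<or>
    (\<exists>u\<in>U. \<exists>b\<in>set verts. (b = v \<or> covers T v b) \<and> u \<noteq> b \<and> (True \<longleftrightarrow> {u, b} \<in> E)) \<and>
    (\<exists>u\<in>U. \<exists>b\<in>set verts. (b = v \<or> covers T v b) \<and> u \<noteq> b \<and> (False \<longleftrightarrow> {u, b} \<in> E))"
proof -
  have "b \<in> window T v \<longleftrightarrow> b \<in> set verts \<and> (b = v \<or> covers T v b)" for b
    using assms T_subset by (auto simp: window_def covers_def set_verts)
  then show ?thesis unfolding cuts_def mixed_def by blast
qed

lemma calls_cut:
  assumes U: "set U \<subseteq> {..<n}" "length U \<le> 2 * N" and v: "v < n"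
  shows "calls prog 15 [encode_part U, encode_nat v, data] (encode_bool (cuts E T (set U) v)) (time_cut N)"
  by (rule callsI, simp add: length_prog, simp add: prog_def,
    (rule ev calls_member calls_block_entry[of U v True] calls_block_entry[of U v False, simplified encode_bool.simps] | (simp add: assms; fail))+,
    simp only: cuts_iff[OF v], simp add: time_cut_def)

definition small_part :: "nat list \<Rightarrow> bool" where
  "small_part X \<longleftrightarrow> X \<noteq> [] \<and> set X \<subseteq> {..<n} \<and> length X \<le> N"

lemma calls_cut_part:
  assumes U: "set U \<subseteq> {..<n}" "length U \<le> 2 * N" and Z: "small_part Z"
  shows "calls prog 16 [encode_part Z, Leaf, Node (encode_part U) data]
    (encode_bool (\<exists>z\<in>set Z. cuts E T (set U) z)) (time_cut_part N)"
proof -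
  have step: "calls prog 17 [encode_nat z, encode_bool a, Node (encode_part U) data]
      (encode_bool (cuts E T (set U) z \<or> a)) (time_cut N + 50)"
    if "z \<in> set Z" for z a
  proof -
    have z: "z < n" using that Z by (auto simp: small_part_def)
    show ?thesis
      by (rule callsI, simp add: length_prog, simp add: prog_def,
        (rule ev calls_cut | (simp add: U z; fail))+)
  qed
  show ?thesis
    unfolding time_cut_part_def
    by (rule calls_exists[OF _ _ step],
      use Z in \<open>simp_all add: length_prog prog_def small_part_def\<close>)
qed

text \<open>Counting down with truncated subtraction replaces a comparison of numbers: the rest is
  positive iff fewer than \<open>b\<close> parts are cut.\<close>

lemma calls_budget_left:
  assumes U: "set U \<subseteq> {..<n}" "length U \<le> 2 * N"
    and ps: "\<And>Z. Z \<in> set ps \<Longrightarrow> small_part Z" "length ps \<le> N"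
  shows "calls prog 18 [encode_list encode_part ps, encode_nat b, Node (encode_part U) data]
    (encode_nat (b - length (filter (\<lambda>Z. \<exists>z\<in>set Z. cuts E T (set U) z) ps))) (time_budget_left N)"
proof -
  have step: "calls prog 19 [encode_part Z, encode_nat a, Node (encode_part U) data]
      (encode_nat (if \<exists>z\<in>set Z. cuts E T (set U) z then a - 1 else a)) (time_cut_part N + 50)"
    if "Z \<in> set ps" for Z a
  proof -
    note Z = ps(1)[OF that]
    show ?thesis
      by (rule callsI, simp add: length_prog, simp add: prog_def,
        (rule ev calls_cut_part | (simp add: U Z; fail))+)
  qed
  have fold: "foldr (\<lambda>Z a. if \<exists>z\<in>set Z. cuts E T (set U) z then a - 1 else a) qs b =
      b - length (filter (\<lambda>Z. \<exists>z\<in>set Z. cuts E T (set U) z) qs)" for qs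
    by (induction qs) auto
  show ?thesis
    unfolding time_budget_left_def
    by (rule calls_cast[OF calls_fold[where enc = encode_part and enc' = encode_nat and h = "\<lambda>Z a. if \<exists>z\<in>set Z. cuts E T (set U) z then a - 1 else a" and d = "time_cut_part N + 100", OF _ _ step ps(2)]],
      simp_all add: length_prog prog_def fold)
qed

lemma calls_adjacent1:
  assumes u: "u < n" and Y: "small_part Y"
  shows "calls prog 20 [encode_part Y, Leaf, Node (encode_nat u) data]
    (encode_bool (\<exists>y\<in>set Y. covers T u y)) (time_adjacent1 N)"
proof -
  have step: "calls prog 21 [encode_nat y, encode_bool a, Node (encode_nat u) data]
      (encode_bool (covers T u y \<or> a)) (time_covers N + 50)"
    if "y \<in> set Y" for y a
  proof -
    have y: "y < n" using that Y by (auto simp: small_part_def)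
    show ?thesis
      by (rule callsI, simp add: length_prog, simp add: prog_def,
        (rule ev calls_covers | (simp add: u y; fail))+)
  qed
  show ?thesis
    unfolding time_adjacent1_def
    by (rule calls_exists[OF _ _ step],
      use Y in \<open>simp_all add: length_prog prog_def small_part_def\<close>)
qed

lemma calls_adjacent:
  assumes X: "small_part X" and Y: "small_part Y"
  shows "calls prog 22 [encode_part X, Leaf, Node (encode_part Y) data]
    (encode_bool (adjacent T (set X) (set Y))) (time_adjacent N)"
proof -
  have step: "calls prog 23 [encode_nat x, encode_bool a, Node (encode_part Y) data]
      (encode_bool ((\<exists>y\<in>set Y. covers T x y) \<or> a)) (time_adjacent1 N + 50)"
    if "x \<in> set X" for x a
  proof -
    have x: "x < n" using that X by (auto simp: small_part_def)
    show ?thesis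
      by (rule callsI, simp add: length_prog, simp add: prog_def,
        (rule ev calls_adjacent1 | (simp add: Y x; fail))+)
  qed
  show ?thesis
    unfolding time_adjacent_def adjacent_def
    by (rule calls_exists[OF _ _ step],
      use X in \<open>simp_all add: length_prog prog_def small_part_def\<close>)
qed

lemma calls_append:
  assumes X: "length X \<le> N"
  shows "calls prog 24 [encode_part X, encode_part Y, Leaf] (encode_part (X @ Y)) (time_append N)"
proof -
  have step: "calls prog 25 [encode_nat x, encode_part a, Leaf] (encode_part (x # a)) 50" for x a
    by (rule callsI, simp add: length_prog, simp add: prog_def, (rule ev | (simp; fail))+)
  have fold: "foldr (#) X Y = X @ Y" by (induction X) auto
  show ?thesis
    by (rule calls_cast[OF calls_fold[where enc = encode_nat and enc' = encode_part and h = "(#)" and d = 100, OF _ _ step X]],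
      simp_all add: length_prog prog_def time_append_def fold)
qed

lemma calls_mergeable:
  assumes X: "small_part X" and Y: "small_part Y"
    and ps: "\<And>Z. Z \<in> set ps \<Longrightarrow> small_part Z" "length ps \<le> N"
  shows "calls prog 26 [encode_part X, encode_part Y, Node (encode_list encode_part ps) data]
    (encode_bool (mergeable E T (9 * k + 2) ps X Y)) (time_mergeable N)"
proof -
  have XY: "X \<noteq> []" "Y \<noteq> []" "hd X < n" "length X \<le> N" "set X \<subseteq> {..<n}" "set Y \<subseteq> {..<n}"
    "length X + length Y \<le> 2 * N"
    using X Y hd_in_set[of X] unfolding small_part_def by (blast, blast, blast, blast, blast, blast, linarith)
  show ?thesis
    by (rule callsI, simp add: length_prog, simp add: prog_def,
      (rule ev calls_adjacent calls_append calls_budget_left X Y | (rule ps(1), assumption) | (simp add: XY ps(2); fail))+,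
      auto simp: mergeable_def time_mergeable_def)
qed

definition encode_pair :: "nat list \<times> nat list \<Rightarrow> tree" where
  "encode_pair = (\<lambda>(X, Y). Node (encode_part X) (encode_part Y))"

lemma calls_select1:
  assumes X: "small_part X"
    and ps: "\<And>Z. Z \<in> set ps \<Longrightarrow> small_part Z" "length ps \<le> N"
  shows "calls prog 27 [encode_list encode_part ps, encode_pair a,
      Node (encode_part X) (Node (encode_list encode_part ps) data)]
    (encode_pair (foldr (\<lambda>Y a. if mergeable E T (9 * k + 2) ps X Y then (X, Y) else a) ps a)) (time_select1 N)"
proof -
  have step: "calls prog 28 [encode_part Y, encode_pair a,
        Node (encode_part X) (Node (encode_list encode_part ps) data)]
      (encode_pair (if mergeable E T (9 * k + 2) ps X Y then (X, Y) else a)) (time_mergeable N + 50)"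
    if "Y \<in> set ps" for Y a
  proof -
    note Y = ps(1)[OF that]
    show ?thesis
      by (rule callsI, simp add: length_prog, simp add: prog_def,
        (rule ev calls_mergeable X Y ps(2) | (rule ps(1), assumption))+, simp_all add: encode_pair_def)
  qed
  show ?thesis
    unfolding time_select1_def
    by (rule calls_fold[where enc = encode_part and enc' = encode_pair, OF _ _ step ps(2)],
      simp_all add: length_prog prog_def)
qed

lemma calls_select:
  assumes ps: "\<And>Z. Z \<in> set ps \<Longrightarrow> small_part Z" "length ps \<le> N"
  shows "calls prog 29 [encode_list encode_part ps, encode_pair (hd ps, hd (tl ps)),
      Node (encode_list encode_part ps) data]
    (encode_pair (select E T (9 * k + 2) ps)) (time_select N)"
proof -
  have step: "calls prog 30 [encode_part X, encode_pair a, Node (encode_list encode_part ps) data]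
      (encode_pair (foldr (\<lambda>Y a. if mergeable E T (9 * k + 2) ps X Y then (X, Y) else a) ps a)) (time_select1 N + 50)"
    if "X \<in> set ps" for X a
  proof -
    note X = ps(1)[OF that]
    show ?thesis
      by (rule callsI, simp add: length_prog, simp add: prog_def,
        (rule ev calls_select1 X ps(2) refl | (rule ps(1), assumption))+, simp)
  qed
  show ?thesis
    unfolding time_select_def select_def
    by (rule calls_fold[where enc = encode_part and enc' = encode_pair, OF _ _ step ps(2)],
      simp_all add: length_prog prog_def)
qed

lemma calls_remove:
  assumes ps: "\<And>Z. Z \<in> set ps \<Longrightarrow> small_part Z" "length ps \<le> N"
  shows "calls prog 31 [encode_list encode_part ps, Leaf, Node (encode_nat p) (encode_nat q)]
    (encode_list encode_part (filter (\<lambda>Z. hd Z \<noteq> p \<and> hd Z \<noteq> q) ps)) (time_remove N)"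
proof -
  have step: "calls prog 32 [encode_part Z, encode_list encode_part a, Node (encode_nat p) (encode_nat q)]
      (encode_list encode_part (if hd Z \<noteq> p \<and> hd Z \<noteq> q then Z # a else a)) (2 * time_eq N + 50)"
    if "Z \<in> set ps" for Z a
  proof -
    have Z: "Z \<noteq> []" "hd Z < n"
      using ps(1)[OF that] hd_in_set[of Z] unfolding small_part_def by blast+
    show ?thesis
      by (rule callsI, simp add: length_prog, simp add: prog_def, (rule ev | (simp add: Z; fail))+)
  qed
  have fold: "foldr (\<lambda>Z a. if hd Z \<noteq> p \<and> hd Z \<noteq> q then Z # a else a) qs [] =
      filter (\<lambda>Z. hd Z \<noteq> p \<and> hd Z \<noteq> q) qs" for qs
    by (induction qs) auto
  have "calls prog 31 [encode_list encode_part ps, encode_list encode_part [], Node (encode_nat p) (encode_nat q)]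
    (encode_list encode_part (foldr (\<lambda>Z a. if hd Z \<noteq> p \<and> hd Z \<noteq> q then Z # a else a) ps [])) (time_remove N)"
    unfolding time_remove_def
    by (rule calls_fold[where enc = encode_part and enc' = "encode_list encode_part", OF _ _ step ps(2)],
      simp_all add: length_prog prog_def)
  then show ?thesis by (simp only: fold encode_list.simps)
qed

lemma small_parts:
  assumes "valid_parts {..<n} ps"
  shows "length ps \<le> N" "\<And>X. X \<in> set ps \<Longrightarrow> small_part X"
  using length_valid_parts_le[OF assms] valid_partsD(2,5)[OF assms] n unfolding small_part_def
  by fastforce+

text \<open>The program has no counter \<open>m\<close>; it stops when the tail of the list of parts
  is \<open>Leaf\<close>, which happens after exactly \<open>m\<close> merges.\<close>

lemma calls_greedy:
  assumes "valid_parts {..<n} ps" "length ps = Suc m"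
  shows "calls prog 34 [encode_list encode_part ps, data, Leaf]
    (encode_list encode_contraction (greedy E T (9 * k + 2) m ps)) ((m + 1) * time_step N)"
  using assms
proof (induction m arbitrary: ps)
  case 0
  then obtain X where ps: "ps = [X]" by (auto simp: length_Suc_conv)
  show ?case
    unfolding ps encode_list.simps
    by (rule callsI, simp add: length_prog, simp add: prog_def, rule evals_If_Node[where t = 0],
      (rule evals_rules)+, simp, rule evals_rules, simp_all add: time_step_def)
next
  case (Suc m)
  note v = Suc.prems(1)
  obtain X Y where sel: "select E T (9 * k + 2) ps = (X, Y)" by force
  have len: "2 \<le> length ps" using Suc.prems(2) by simp
  note XY = select_distinct[OF v len sel]
  note small = small_parts[OF v]
  have ne: "X \<noteq> []" "Y \<noteq> []" "length X \<le> N" "ps \<noteq> []" "tl ps \<noteq> []"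
    using small(2)[OF XY(1)] small(2)[OF XY(2)] len by (auto simp: small_part_def neq_Nil_conv Suc_le_length_iff numeral_2_eq_2)
  have IH: "calls prog 34 [encode_list encode_part (merge_parts X Y ps), data, Leaf]
    (encode_list encode_contraction (greedy E T (9 * k + 2) m (merge_parts X Y ps))) ((m + 1) * time_step N)"
    using valid_merge_parts[OF v XY] length_merge_parts[OF v XY] Suc.prems(2) by (intro Suc.IH) auto
  have step: "calls prog 33 [Node (encode_part X) (encode_part Y), encode_list encode_part ps, data]
    (encode_list encode_contraction (greedy E T (9 * k + 2) (Suc m) ps))
    (time_append N + time_remove N + 100 + (m + 1) * time_step N)"
    by (rule callsI, simp add: length_prog, simp add: prog_def,
      (rule ev calls_append calls_remove IH[unfolded merge_parts_def] | (rule small(2), assumption) | (simp add: ne small(1); fail))+,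
      simp only: greedy.simps sel Let_def prod.case encode_list.simps encode_contraction.simps encode_bool.simps merge_parts_def,
      simp)
  have select: "calls prog 29 [encode_list encode_part ps,
      Node (encode_part (hd ps)) (encode_part (hd (tl ps))), Node (encode_list encode_part ps) data]
    (Node (encode_part X) (encode_part Y)) (time_select N)"
    using calls_select[OF small(2,1)] unfolding sel encode_pair_def prod.case .
  have right: "right (encode_list encode_part ps) \<noteq> Leaf"
    using ne by (cases ps; cases "tl ps") auto
  show ?case
    by (rule callsI, simp add: length_prog, simp add: prog_def, rule evals_If_Node[where t' = 0],
      rule evals_right, rule evals_rules, (rule ev step select | (simp add: ne; fail))+,
      simp_all add: right time_step_def)
qed

lemma calls_verts:
  "calls prog 35 [encode_rel n R, Leaf, Leaf] (encode_part verts) ((N + 1) * 100)"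
proof -
  let ?f = "\<lambda>u. encode_list (\<lambda>v. encode_bool ((u, v) \<in> R)) [0..<n]"
  let ?h = "\<lambda>(_ :: nat) a. (case a of [] \<Rightarrow> 0 | u # _ \<Rightarrow> Suc u) # a"
  have step: "calls prog 36 [?f x, encode_part a, Leaf] (encode_part (?h x a)) 50" for x a
  proof (cases a)
    case Nil
    show ?thesis
      unfolding Nil encode_list.simps list.case
      by (rule callsI, simp add: length_prog, simp add: prog_def, rule evals_Mk_Node,
        rule evals_If_Node[where t = 0], rule evals_rules, simp, (rule evals_rules)+, simp_all)
  next
    case (Cons u us)
    show ?thesis
      unfolding Cons encode_list.simps list.case
      by (rule callsI, simp add: length_prog, simp add: prog_def, rule evals_Mk_Node,
        rule evals_If_Node[where t' = 0], (rule evals_rules)+, simp_all, (rule evals_rules)+, simp)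
  qed
  have "foldr ?h xs [] = rev [0..<length xs]" for xs
  proof (induction xs)
    case (Cons x xs)
    then show ?case by (cases "length xs") auto
  qed simp
  from this[of "[0..<n]"] have fold: "foldr ?h [0..<n] [] = verts" by (simp add: verts_def)
  have "calls prog 35 [encode_list ?f [0..<n], encode_part [], Leaf] (encode_part (foldr ?h [0..<n] [])) ((N + 1) * 100)"
    by (rule calls_fold[where enc = ?f and enc' = encode_part, OF _ _ step]) (simp_all add: length_prog prog_def n)
  then show ?thesis by (simp only: fold encode_list.simps encode_rel_def)
qed

lemma calls_singletons:
  "calls prog 37 [encode_part verts, Leaf, Leaf] (encode_list encode_part (map (\<lambda>v. [v]) verts)) ((N + 1) * 100)"
proof -
  have step: "calls prog 38 [encode_nat x, encode_list encode_part a, Leaf] (encode_list encode_part ([x] # a)) 50" for x a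
    by (rule callsI, simp add: length_prog, simp add: prog_def, (rule evals_rules)+, simp_all)
  have fold: "foldr (\<lambda>x a. [x] # a) xs [] = map (\<lambda>v. [v]) xs" for xs :: "nat list"
    by (induction xs) auto
  have "calls prog 37 [encode_part verts, encode_list encode_part [], Leaf]
    (encode_list encode_part (foldr (\<lambda>x a. [x] # a) verts [])) ((N + 1) * 100)"
    by (rule calls_fold[where enc = encode_nat and enc' = "encode_list encode_part", OF _ _ step length_verts])
      (simp_all add: length_prog prog_def)
  then show ?thesis by (simp only: fold encode_list.simps)
qed

text \<open>\<open>k\<close> is not part of the input as a number. It is read off from the length of
  the list of orders, 9 for each entry on top of the initial 2.\<close>

lemma calls_budget:
  "calls prog 39 [orders, encode_nat 2, Leaf] (encode_nat (9 * k + 2)) ((N + 1) * 100)"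
proof -
  have step: "calls prog 40 [f x, encode_nat a, Leaf] (encode_nat (a + 9)) 50" for f :: "nat \<Rightarrow> tree" and x a
    by (rule callsI, simp add: length_prog, simp add: prog_def, (rule evals_rules)+,
      simp_all add: numeral_eq_Suc)
  have fold: "foldr (\<lambda>x a. a + 9) xs b = 9 * length xs + b" for xs :: "nat list" and b :: nat
    by (induction xs) auto
  have "calls prog 39 [orders, encode_nat 2, Leaf] (encode_nat (foldr (\<lambda>x a. a + 9) [1..<Suc k] 2)) ((N + 1) * 100)"
    unfolding orders_def
    by (rule calls_fold[where enc' = encode_nat, OF _ _ step]) (simp_all add: length_prog prog_def k del: upt_Suc)
  then show ?thesis by (simp only: fold length_upt diff_Suc_1)
qed

lemma valid_verts: "valid_parts {..<n} (map (\<lambda>v. [v]) verts)"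
proof -
  have "concat (map (\<lambda>v. [v]) verts) = verts" by (induction verts) auto
  then show ?thesis
    by (auto simp: valid_parts_def set_verts) (simp add: verts_def)
qed

definition "output = greedy E T (9 * k + 2) (n - 1) (map (\<lambda>v. [v]) verts)"

lemma evals_main:
  assumes "0 < n"
  shows "evals prog [encode_input k n E P L] (prog ! 0) (encode_list encode_contraction output)
    (N * time_step N + 300 * (N + 1) + 100)"
proof -
  have "length (map (\<lambda>v. [v]) verts) = Suc (n - 1)" using assms by (simp add: verts_def)
  note greedy = calls_greedy[OF valid_verts this]
  have "n * time_step N \<le> N * time_step N" using n by simp
  then have le: "(n - 1 + 1) * time_step N \<le> N * time_step N" using assms by simp
  have main: "calls prog (Suc 0) [data, Leaf, Leaf] (encode_list encode_contraction output)
    ((N + 1) * 100 + N * time_step N + 50)"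
    by (rule callsI, simp add: length_prog, simp add: prog_def, (rule ev calls_singletons greedy)+,
      simp add: output_def, use le in \<open>simp\<close>)
  have budget: "calls prog 39 [orders, Node Leaf (Node Leaf Leaf), Leaf] (encode_nat (9 * k + 2)) ((N + 1) * 100)"
    using calls_budget by (simp add: numeral_2_eq_2)
  have prog0: "prog ! 0 = Call (Suc 0) [Mk_Node (Left arg0) (Mk_Node (Right (Right arg0)) (Mk_Node
      (Call 35 [Left arg0, Mk_Leaf, Mk_Leaf])
      (Call 39 [Right (Right arg0), Mk_Node Mk_Leaf (Mk_Node Mk_Leaf Mk_Leaf), Mk_Leaf]))), Mk_Leaf, Mk_Leaf]"
    by (simp add: prog_def)
  show ?thesis
    unfolding prog0 encode_input_def orders_def[symmetric]
    by (rule evals_mono, (rule evals_rules calls_verts budget main[unfolded data_def])+, simp)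
qed

lemma size_encode_nat: "size (encode_nat m) = m"
  by (induction m) auto

text \<open>A round writes two contractions and hence four unary names of size at most
  \<open>N\<close>; the 20 covers the remaining nodes.\<close>

lemma size_greedy:
  assumes "valid_parts {..<n} ps" "length ps = Suc m"
  shows "size (encode_list encode_contraction (greedy E T b m ps)) \<le> m * (4 * N + 20)"
  using assms
proof (induction m arbitrary: ps)
  case (Suc m)
  obtain X Y where sel: "select E T b ps = (X, Y)" by force
  have "2 \<le> length ps" using Suc.prems(2) by simp
  note XY = select_distinct[OF Suc.prems(1) this sel]
  have "hd X \<in> {..<n}" "hd Y \<in> {..<n}"
    using XY valid_partsD(4,5)[OF Suc.prems(1)] by blast+
  then have "hd X \<le> N" "hd Y \<le> N" using n by auto
  moreover have "size (encode_list encode_contraction (greedy E T b m (merge_parts X Y ps))) \<le> m * (4 * N + 20)"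
    using Suc.IH[OF valid_merge_parts[OF Suc.prems(1) XY]] length_merge_parts[OF Suc.prems(1) XY] Suc.prems(2) by simp
  ultimately show ?case
    by (simp add: sel size_encode_nat)
qed simp

lemma computes_output:
  assumes "0 < n"
  shows "computes_within prog (encode_input k n E P L) (encode_list encode_contraction output)
    (N * time_step N + 300 * (N + 1) + 100 + N * (4 * N + 20))"
proof -
  have "size (encode_list encode_contraction output) \<le> (n - 1) * (4 * N + 20)"
    unfolding output_def using valid_verts assms by (intro size_greedy) (auto simp: verts_def)
  also have "\<dots> \<le> N * (4 * N + 20)" using n by (intro mult_le_mono1) auto
  finally have size: "size (encode_list encode_contraction output) \<le> N * (4 * N + 20)" .
  obtain t where "t \<le> N * time_step N + 300 * (N + 1) + 100"
    "run prog [encode_input k n E P L] (prog ! 0) (encode_list encode_contraction output) t"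
    using evals_main[OF assms] unfolding evals_def by blast
  moreover have "prog \<noteq> []" by (simp add: prog_def)
  ultimately show ?thesis using size unfolding computes_within_def by (meson add_mono)
qed

end

section \<open>Polynomial bounds and the final theorem\<close>

definition poly_bounded :: "(nat \<Rightarrow> nat) \<Rightarrow> bool" where
  "poly_bounded f \<longleftrightarrow> (\<exists>p. \<forall>x. f x \<le> poly p x)"

lemma poly_bounded_const: "poly_bounded (\<lambda>x. c)"
  unfolding poly_bounded_def by (rule exI[of _ "[:c:]"]) simp

lemma poly_bounded_ident: "poly_bounded (\<lambda>x. x)"
  unfolding poly_bounded_def by (rule exI[of _ "[:0, 1:]"]) simp

lemma poly_bounded_add: "poly_bounded f \<Longrightarrow> poly_bounded g \<Longrightarrow> poly_bounded (\<lambda>x. f x + g x)"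
  unfolding poly_bounded_def by (metis add_mono poly_add)

lemma poly_bounded_mult: "poly_bounded f \<Longrightarrow> poly_bounded g \<Longrightarrow> poly_bounded (\<lambda>x. f x * g x)"
  unfolding poly_bounded_def by (metis mult_le_mono poly_mult)

lemma poly_bounded_time: "poly_bounded (\<lambda>N. N * time_step N + 300 * (N + 1) + 100 + N * (4 * N + 20))"
  unfolding time_step_def time_select_def time_select1_def time_remove_def time_mergeable_def time_append_def
    time_adjacent_def time_adjacent1_def time_budget_left_def time_cut_part_def time_cut_def time_member_def
    time_block_entry_def time_row_entry_def time_covers_def time_between_def time_order_def time_eq_def time_entry_def
  by (intro poly_bounded_const poly_bounded_ident poly_bounded_add poly_bounded_mult)

text \<open>Bounds \<open>n\<close> and \<open>k\<close> by the input size, through the rows of the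
  adjacency matrix and the list of classes.\<close>

lemma length_le_size_encode_list: "length xs \<le> size (encode_list f xs)"
  by (induction xs) auto

theorem theorem4p1:
  shows "(\<forall>k (V :: 'a set) E.
      k \<ge> 1 \<and> simple_graph V E \<and> V \<noteq> {} \<and> proper_mixed_thin k V E \<longrightarrow>
      twin_width V E \<le> enat (9 * k))
    \<and> (\<exists>(Q :: program) (p :: nat poly). \<forall>k n E P L.
      k \<ge> 1 \<and> simple_graph {0..<n} E \<and> {0..<n} \<noteq> {} \<and>
      (\<exists>F. mixed_thin_witness k {0..<n} E P L F) \<longrightarrow>
      (\<exists>cs. symmetric_contraction_sequence (9 * k) (adjacency_matrix {0..<n} E) cs \<and>
        computes_within Q (encode_input k n E P L) (encode_list encode_contraction cs)
          (poly p (size (encode_input k n E P L)))))"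
proof (rule conjI)
  show "\<forall>k (V :: 'a set) E. k \<ge> 1 \<and> simple_graph V E \<and> V \<noteq> {} \<and> proper_mixed_thin k V E \<longrightarrow>
      twin_width V E \<le> enat (9 * k)"
  proof (intro allI impI; elim conjE)
    fix k and V :: "'a set" and E
    assume k: "k \<ge> 1" and g: "simple_graph V E" and V: "V \<noteq> {}" and "proper_mixed_thin k V E"
    then obtain P L F where "mixed_thin_witness k V E P L F" by (auto simp: proper_mixed_thin_def)
    with g interpret mixed_thin k V E P L F by unfold_locales
    obtain vs where "distinct vs" "set vs = V" using finite_distinct_list[OF finite_V] by blast
    then show "twin_width V E \<le> enat (9 * k)"
      using greedy_singletons[OF k _ _ V] unfolding twin_width_def symmetric_twin_width_def
      by (intro Inf_lower) blast
  qed
next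
  obtain p where p: "\<And>N. N * time_step N + 300 * (N + 1) + 100 + N * (4 * N + 20) \<le> poly p N"
    using poly_bounded_time unfolding poly_bounded_def by blast
  show "\<exists>(Q :: program) (p :: nat poly). \<forall>k n E P L.
      k \<ge> 1 \<and> simple_graph {0..<n} E \<and> {0..<n} \<noteq> {} \<and>
      (\<exists>F. mixed_thin_witness k {0..<n} E P L F) \<longrightarrow>
      (\<exists>cs. symmetric_contraction_sequence (9 * k) (adjacency_matrix {0..<n} E) cs \<and>
        computes_within Q (encode_input k n E P L) (encode_list encode_contraction cs)
          (poly p (size (encode_input k n E P L))))"
  proof (intro exI[of _ prog] exI[of _ p] allI impI; elim conjE exE)
    fix k n :: nat and E P L F
    assume k_pos: "k \<ge> 1" and g: "simple_graph {0..<n} E" and ne: "{0..<n} \<noteq> {}"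
      and "mixed_thin_witness k {0..<n} E P L F"
    with g interpret G: mixed_thin k "{0..<n}" E P L F by unfold_locales
    let ?N = "size (encode_input k n E P L)"
    have "n \<le> ?N"
      using length_le_size_encode_list[of "[0..<n]" "\<lambda>u. encode_list (\<lambda>v. encode_bool ({u, v} \<in> E)) [0..<n]"]
      by (simp add: encode_input_def encode_rel_def)
    moreover have "k \<le> ?N"
      using length_le_size_encode_list[of "[1..<Suc k]" "\<lambda>i. encode_set n (P i)"]
      by (simp add: encode_input_def del: upt_Suc)
    ultimately interpret program_input n k ?N E L G.T
      using G.T_subset by unfold_locales (auto simp: G.T_def atLeast0LessThan)
    have "distinct verts" "set verts = {0..<n}" "length verts = n" by (auto simp: verts_def)
    then have "symmetric_contraction_sequence (9 * k) (adjacency_matrix {0..<n} E) output"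
      using G.greedy_singletons[OF k_pos _ _ ne, of verts] by (simp add: output_def)
    moreover have "computes_within prog (encode_input k n E P L) (encode_list encode_contraction output) (poly p ?N)"
      using computes_output[of P] p[of ?N] ne unfolding computes_within_def by (auto intro: order_trans)
    ultimately show "\<exists>cs. symmetric_contraction_sequence (9 * k) (adjacency_matrix {0..<n} E) cs \<and>
        computes_within prog (encode_input k n E P L) (encode_list encode_contraction cs) (poly p ?N)"
      by blast
  qed
qed

end
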